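(* Let $S\subset\mathbb R$ be an interval, let $U$ be a unitary operator on $L^2(S)$, and let $\mathcal X$ and $X$ satisfy the structural assumptions (A1) and (A2) listed in the context. Let $\Lambda=\{\lambda_j:j\in J\}$ and $M=\{\mu_j:j\in J\}$ be discrete subsets of $S$ with strictly increasing enumerations that decompose $S$ into the intervals $(\lambda_j,\lambda_{j+1})$, respectively $(\mu_j,\mu_{j+1})$, where $J=\mathbb Z$ (two-sided case) or $J=\mathbb N$ (one-sided case). Assume that kinetic Dirichlet confinement is admissible for $(\Lambda,M)$ and that $(\Lambda,M)$ has uniformly supercritical kinetic confinement for $U$, i.e. $$\inf_{j}\frac{\sqrt{\kappa^{U}_{[\lambda_j,\lambda_{j+1}]}}}{\max\{|\lambda_j|,|\lambda_{j+1}|\}}>1\quad\text{and}\quad\inf_{j}\frac{\sqrt{\kappa^{U^*}_{[\mu_j,\mu_{j+1}]}}}{\max\{|\mu_j|,|\mu_{j+1}|\}}>1.$$ Then the only function $f\in\mathcal X$ satisfying $f(\lambda_i)=0$ and $(Uf)(\mu_i)=0$ for all $i\in J$ is $f=0$.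
   Context: Structural assumptions on $U$, $\mathcal X$, $X$. $M_{x^2}$ denotes the self-adjoint multiplication operator $f\mapsto x^2f$ on $L^2(S)$, so $\mathcal D(M_{x^2}^{1/2})=\{f\in L^2(S): xf\in L^2(S)\}$. (A1) $\mathcal X\subset L^2(S)$ is a Hilbert space, continuously embedded in $L^2(S)$, with $U\mathcal X=\mathcal X$. It embeds locally into continuous functions on $S$, so that point evaluations of $f\in\mathcal X$ and of $Uf\in\mathcal X$ are meaningful. Moreover, $\mathcal X$ is the form domain of a strictly positive self-adjoint operator $X$ on $L^2(S)$, that is $\mathcal X=\mathcal D(X^{1/2})$, and also $\mathcal X=\mathrm{Ran}(X^{-1/2})$. (A2) In the sense of closed quadratic forms $X=\frac12(M_{x^2}+U^*M_{x^2}U)$: the quadratic form of $X$ is $$x[f]=\tfrac12\big(\|M_{x^2}^{1/2}f\|_{L^2(S)}^2+\|M_{x^2}^{1/2}Uf\|_{L^2(S)}^2\big),\quad f\in\mathcal X,$$ with form domain $\mathcal X=\mathcal D(M_{x^2}^{1/2})\cap U^*\mathcal D(M_{x^2}^{1/2})$, which is assumed dense in $L^2(S)$ (so the form is densely defined, closed and non-negative). The norm of $\mathcal X$ is $\|f\|_{\mathcal X}^2=2x[f]$. Kinetic forms. On $\mathcal X$ put $K_U=U^*M_{x^2}U$, $K_{U^*}=UM_{x^2}U^*$, $k^U[f]=\|K_U^{1/2}f\|^2_{L^2(S)}$ and $k^{U^*}[f]=\|K_{U^*}^{1/2}f\|^2_{L^2(S)}$. Confinements. For a bounded interval $I=[a,b]\subset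 S$, $k^U_I$ and $k^{U^*}_I$ denote the Dirichlet confinements of $k^U$ and $k^{U^*}$ to $I$: the closed non-negative quadratic forms on $L^2(I)$, with form domains $\mathcal Q(k_I^U)$, $\mathcal Q(k_I^{U^*})$, obtained by imposing the boundary conditions $g(a)=g(b)=0$. It is part of the setting that these confined forms are well defined. Their spectral floors are $$\kappa_I^U=\inf_{0\ne g\in\mathcal Q(k_I^U)}\frac{k_I^U[g]}{\|g\|_{L^2(I)}^2},\qquad \kappa_I^{U^*}=\inf_{0\ne g\in\mathcal Q(k_I^{U^*})}\frac{k_I^{U^*}[g]}{\|g\|_{L^2(I)}^2}.$$ Admissibility. A closed, densely defined, non-negative form $y$ is compatible with local Dirichlet confinement on a decomposition of $S$ into pairwise disjoint intervals $I_j=(a_j,a_{j+1})$ if, for every $g$ in the domain of $y$ that (has a representative that) vanishes at all interior endpoints $a_j$, one has $g|_{I_j}\in\mathcal Q(y_{I_j})$ for every $j$ and $y[g]\ge\sum_j y_{I_j}[g|_{I_j}]$, where $y_{I_j}$ is the Dirichlet confinement of $y$ to $I_j$. Kinetic Dirichlet confinement is admissible for $(\Lambda,M)$ if $k^U$ is compatible with local Dirichlet confinement on the decomposition induced by $\Lambda$, and $k^{U^*}$ is compatible with local Dirichlet confinement on the decomposition induced by $M$. In particular, whenever $f\in\mathcal X$ with $f|_\Lambda=0$ and $Uf|_M=0$, $$k^U[f]\ge\sum_jk^U_{[\lambda_j,\lambda_{j+1}]}\big[f|_{[\lambda_j,\lambda_{j+1}]}\big],\qquad k^{U^*}[Uf]\ge\sum_jk^{U^*}_{[\mu_j,\mu_{j+1}]}\big[(Uf)|_{[\mu_j,\mu_{j+1}]}\big].$$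 *)

theory Defs
  imports "HOL-Analysis.Analysis"
begin

section \<open>The Hilbert space of square-integrable functions on a set\<close>

text \<open>
  Elements of \<open>L\<^sup>2(T)\<close> are represented by total functions. Values off \<open>T\<close> are irrelevant and
  equality in \<open>L\<^sup>2(T)\<close> is \<open>ae_eq T\<close>. Hence, for \<open>I \<subseteq> T\<close>, the restriction to \<open>I\<close> of the element
  represented by \<open>f\<close> is represented by \<open>f\<close> itself. Only \<open>zero_ext I f\<close>, the extension by zero
  of \<open>f\<close> from \<open>I\<close>, changes the representative.
\<close>

type_synonym fn = "real \<Rightarrow> complex"

definition ae_eq :: "real set \<Rightarrow> fn \<Rightarrow> fn \<Rightarrow> bool" where
  "ae_eq T f g \<longleftrightarrow> (AE x in lebesgue_on T. f x = g x)"

definition L2 :: "real set \<Rightarrow> fn set" where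
  "L2 T = {f. f \<in> borel_measurable (lebesgue_on T) \<and>
              integrable (lebesgue_on T) (\<lambda>x. (cmod (f x))\<^sup>2)}"

definition l2_inner :: "real set \<Rightarrow> fn \<Rightarrow> fn \<Rightarrow> complex" where
  "l2_inner T f g = (LINT x|lebesgue_on T. f x * cnj (g x))"

definition l2_norm :: "real set \<Rightarrow> fn \<Rightarrow> real" where
  "l2_norm T f = sqrt (LINT x|lebesgue_on T. (cmod (f x))\<^sup>2)"

definition zero_ext :: "real set \<Rightarrow> fn \<Rightarrow> fn" where
  "zero_ext I f = (\<lambda>x. if x \<in> I then f x else 0)"

definition l2_subspace :: "real set \<Rightarrow> fn set \<Rightarrow> bool" where
  "l2_subspace T V \<longleftrightarrow>
     V \<subseteq> L2 T \<and> (\<lambda>_. 0) \<in> V \<and>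
     (\<forall>f\<in>V. \<forall>g\<in>V. (\<lambda>x. f x + g x) \<in> V) \<and>
     (\<forall>c. \<forall>f\<in>V. (\<lambda>x. c * f x) \<in> V) \<and>
     (\<forall>f\<in>V. \<forall>g\<in>L2 T. ae_eq T f g \<longrightarrow> g \<in> V)"

definition l2_dense :: "real set \<Rightarrow> fn set \<Rightarrow> bool" where
  "l2_dense T V \<longleftrightarrow>
     V \<subseteq> L2 T \<and> (\<forall>f\<in>L2 T. \<forall>e>0. \<exists>g\<in>V. l2_norm T (\<lambda>x. f x - g x) < e)"

definition cont_rep :: "real set \<Rightarrow> fn \<Rightarrow> fn \<Rightarrow> bool" where
  "cont_rep T f h \<longleftrightarrow> continuous_on T h \<and> ae_eq T f h"

text \<open>Point evaluation is that of the continuous representative, which is unique on a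
  nondegenerate interval.\<close>

definition pt_eval :: "real set \<Rightarrow> fn \<Rightarrow> real \<Rightarrow> complex" where
  "pt_eval T f x = (SOME h. cont_rep T f h) x"


section \<open>Operators\<close>

text \<open>
  A (possibly unbounded) operator is its graph, a set of pairs of representatives closed under
  \<open>ae_eq\<close> in both components. Then \<open>Domain\<close>, \<open>Range\<close>, the converse (inverse operator) and
  composition have their usual meaning, with maximal domains, and equality of operators is
  equality of sets. Note that \<open>R O R'\<close> applies \<open>R\<close> first.
\<close>

type_synonym opr = "(fn \<times> fn) set"

definition app :: "opr \<Rightarrow> fn \<Rightarrow> fn" where
  "app A f = (SOME g. (f, g) \<in> A)"

definition linear_opr :: "real set \<Rightarrow> opr \<Rightarrow> bool" where
  "linear_opr T A \<longleftrightarrow>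
     A \<subseteq> L2 T \<times> L2 T \<and>
     ((\<lambda>_. 0), (\<lambda>_. 0)) \<in> A \<and>
     (\<forall>(f, f') \<in> A. \<forall>(g, g') \<in> A. ((\<lambda>x. f x + g x), (\<lambda>x. f' x + g' x)) \<in> A) \<and>
     (\<forall>c. \<forall>(f, f') \<in> A. ((\<lambda>x. c * f x), (\<lambda>x. c * f' x)) \<in> A) \<and>
     (\<forall>(f, f') \<in> A. \<forall>g\<in>L2 T. \<forall>g'\<in>L2 T. ae_eq T f g \<and> ae_eq T f' g' \<longrightarrow> (g, g') \<in> A) \<and>
     (\<forall>f'. ((\<lambda>_. 0), f') \<in> A \<longrightarrow> ae_eq T f' (\<lambda>_. 0))"

definition unitary :: "real set \<Rightarrow> opr \<Rightarrow> bool" where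
  "unitary T U \<longleftrightarrow>
     linear_opr T U \<and> Domain U = L2 T \<and> Range U = L2 T \<and>
     (\<forall>(f, f') \<in> U. \<forall>(g, g') \<in> U. l2_inner T f' g' = l2_inner T f g)"

definition l2_adjoint :: "real set \<Rightarrow> opr \<Rightarrow> opr" where
  "l2_adjoint T A = {(g, h). g \<in> L2 T \<and> h \<in> L2 T \<and>
                          (\<forall>(f, f') \<in> A. l2_inner T f' g = l2_inner T f h)}"

text \<open>Linearity and single-valuedness (modulo \<open>ae_eq\<close>) follow from the two conditions.\<close>

definition self_adjoint :: "real set \<Rightarrow> opr \<Rightarrow> bool" where
  "self_adjoint T A \<longleftrightarrow> l2_dense T (Domain A) \<and> l2_adjoint T A = A"

definition nonneg_opr :: "real set \<Rightarrow> opr \<Rightarrow> bool" where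
  "nonneg_opr T A \<longleftrightarrow> (\<forall>(f, g) \<in> A. 0 \<le> Re (l2_inner T g f))"

definition strictly_pos_opr :: "real set \<Rightarrow> opr \<Rightarrow> bool" where
  "strictly_pos_opr T A \<longleftrightarrow>
     (\<forall>(f, g) \<in> A. \<not> ae_eq T f (\<lambda>_. 0) \<longrightarrow> 0 < Re (l2_inner T g f))"

text \<open>The operator \<open>A\<^sup>1\<^sup>/\<^sup>2\<close>: the non-negative self-adjoint operator whose square is \<open>A\<close>. It exists
  and is unique when \<open>A\<close> is self-adjoint and non-negative.\<close>

definition op_sqrt :: "real set \<Rightarrow> opr \<Rightarrow> opr" where
  "op_sqrt T A = (SOME R. self_adjoint T R \<and> nonneg_opr T R \<and> R O R = A)"

definition mult_sq :: "real set \<Rightarrow> opr" where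
  "mult_sq T = {(f, g). f \<in> L2 T \<and> g \<in> L2 T \<and> ae_eq T g (\<lambda>x. (complex_of_real x)\<^sup>2 * f x)}"


section \<open>Quadratic forms and their Dirichlet confinements\<close>

text \<open>The values \<open>qval q f\<close> are meaningful only for \<open>f \<in> qdom q\<close>.\<close>

record qform =
  qdom :: "fn set"
  qval :: "fn \<Rightarrow> real"

definition closed_form :: "real set \<Rightarrow> qform \<Rightarrow> bool" where
  "closed_form T q \<longleftrightarrow>
     l2_subspace T (qdom q) \<and> l2_dense T (qdom q) \<and>
     (\<forall>f\<in>qdom q. 0 \<le> qval q f) \<and>
     (\<forall>f\<in>qdom q. \<forall>g\<in>qdom q. ae_eq T f g \<longrightarrow> qval q f = qval q g) \<and>
     (\<forall>c. \<forall>f\<in>qdom q. qval q (\<lambda>x. c * f x) = (cmod c)\<^sup>2 * qval q f) \<and>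
     (\<forall>f\<in>qdom q. \<forall>g\<in>qdom q.
        qval q (\<lambda>x. f x + g x) + qval q (\<lambda>x. f x - g x) = 2 * qval q f + 2 * qval q g) \<and>
     (\<forall>s. \<forall>f\<in>L2 T.
        (\<forall>n::nat. s n \<in> qdom q) \<and>
        (\<lambda>n. l2_norm T (\<lambda>x. s n x - f x)) \<longlonglongrightarrow> 0 \<and>
        (\<forall>e>0. \<exists>N. \<forall>m\<ge>N. \<forall>n\<ge>N. qval q (\<lambda>x. s m x - s n x) < e)
        \<longrightarrow> f \<in> qdom q \<and> (\<lambda>n. qval q (\<lambda>x. s n x - f x)) \<longlonglongrightarrow> 0)"

definition op_form :: "real set \<Rightarrow> opr \<Rightarrow> qform" where
  "op_form T A = \<lparr> qdom = Domain (op_sqrt T A),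
                   qval = (\<lambda>f. (l2_norm T (app (op_sqrt T A) f))\<^sup>2) \<rparr>"

text \<open>
  The Dirichlet confinement to \<open>[a,b]\<close> of a closed form \<open>y\<close> on \<open>L\<^sup>2(T)\<close>: restrict \<open>y\<close> to the
  functions on \<open>[a,b]\<close> (extended by zero) that are continuous up to the endpoints and satisfy the
  boundary conditions, then take the closure in the form norm. As \<open>y\<close> is closed,
  the closure stays inside \<open>qdom y\<close> and needs no separate closability assumption. If the
  restricted form is itself closed, the closure adds nothing. For \<open>y[f] = \<parallel>f'\<parallel>\<^sup>2\<close> on the Sobolev
  space \<open>H\<^sup>1(\<real>)\<close>, the result is the Dirichlet form on \<open>H\<^sup>1\<^sub>0(a,b)\<close>.
\<close>

definition dirichlet_core :: "qform \<Rightarrow> real \<Rightarrow> real \<Rightarrow> fn set" where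
  "dirichlet_core y a b =
     {g \<in> L2 {a..b}. zero_ext {a..b} g \<in> qdom y \<and>
                     (\<exists>h. cont_rep {a..b} g h \<and> h a = 0 \<and> h b = 0)}"

definition dirichlet_conf :: "qform \<Rightarrow> real \<Rightarrow> real \<Rightarrow> qform" where
  "dirichlet_conf y a b =
     \<lparr> qdom = {g \<in> L2 {a..b}. zero_ext {a..b} g \<in> qdom y \<and>
                (\<exists>s. (\<forall>n::nat. s n \<in> dirichlet_core y a b) \<and>
                     (\<lambda>n. l2_norm {a..b} (\<lambda>x. s n x - g x)) \<longlonglongrightarrow> 0 \<and>
                     (\<lambda>n. qval y (zero_ext {a..b} (\<lambda>x. s n x - g x))) \<longlonglongrightarrow> 0)},
       qval = (\<lambda>g. qval y (zero_ext {a..b} g)) \<rparr>"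

text \<open>Extended-real valued, so that a form with trivial domain has floor \<open>\<infinity>\<close>.\<close>

definition spectral_floor :: "qform \<Rightarrow> real \<Rightarrow> real \<Rightarrow> ereal" where
  "spectral_floor q a b =
     (INF g \<in> {g \<in> qdom q. \<not> ae_eq {a..b} g (\<lambda>_. 0)}. ereal (qval q g / (l2_norm {a..b} g)\<^sup>2))"

definition ereal_sqrt :: "ereal \<Rightarrow> ereal" where
  "ereal_sqrt x = (case x of ereal r \<Rightarrow> ereal (sqrt r) | PInfty \<Rightarrow> \<infinity> | MInfty \<Rightarrow> -\<infinity>)"


section \<open>Sampling sets, admissibility and supercriticality\<close>

text \<open>The index set \<open>J\<close> is \<open>UNIV\<close> (two-sided) or \<open>{0..}\<close> (one-sided). Endpoints of \<open>S\<close> that do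
  not belong to the sampling set are left out of the decomposition.\<close>

definition decomposes :: "real set \<Rightarrow> int set \<Rightarrow> (int \<Rightarrow> real) \<Rightarrow> bool" where
  "decomposes S J a \<longleftrightarrow>
     a ` J \<subseteq> S \<and> discrete (a ` J) \<and> strict_mono_on J a \<and>
     interior S - a ` J = (\<Union>j\<in>J. {a j<..<a (j + 1)})"

text \<open>
  Every class has representatives vanishing on a given countable set; the representative in the
  condition on \<open>g\<close> is therefore the continuous one. The sum is taken in \<open>ennreal\<close>, so that
  a divergent sum is infinite.
\<close>

definition dirichlet_compatible :: "real set \<Rightarrow> qform \<Rightarrow> int set \<Rightarrow> (int \<Rightarrow> real) \<Rightarrow> bool" where
  "dirichlet_compatible S y J a \<longleftrightarrow>
     closed_form S y \<and>
     (\<forall>g\<in>qdom y. (\<exists>h. cont_rep S g h \<and> (\<forall>j\<in>J. a j \<in> interior S \<longrightarrow> h (a j) = 0)) \<longrightarrow>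
        (\<forall>j\<in>J. g \<in> qdom (dirichlet_conf y (a j) (a (j + 1)))) \<and>
        (\<Sum>\<^sub>\<infinity>j\<in>J. ennreal (qval (dirichlet_conf y (a j) (a (j + 1))) g)) \<le> ennreal (qval y g))"

definition kinetic :: "real set \<Rightarrow> opr \<Rightarrow> opr" where
  "kinetic S V = V O mult_sq S O l2_adjoint S V"

abbreviation kinetic_form :: "real set \<Rightarrow> opr \<Rightarrow> qform" where
  "kinetic_form S V \<equiv> op_form S (kinetic S V)"

definition kinetic_admissible ::
    "real set \<Rightarrow> opr \<Rightarrow> int set \<Rightarrow> (int \<Rightarrow> real) \<Rightarrow> (int \<Rightarrow> real) \<Rightarrow> bool" where
  "kinetic_admissible S U J lam mu \<longleftrightarrow>
     dirichlet_compatible S (kinetic_form S U) J lam \<and>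
     dirichlet_compatible S (kinetic_form S (l2_adjoint S U)) J mu"

definition kinetic_floor :: "real set \<Rightarrow> opr \<Rightarrow> real \<Rightarrow> real \<Rightarrow> ereal" where
  "kinetic_floor S V a b = spectral_floor (dirichlet_conf (kinetic_form S V) a b) a b"

definition uniformly_supercritical ::
    "real set \<Rightarrow> opr \<Rightarrow> int set \<Rightarrow> (int \<Rightarrow> real) \<Rightarrow> (int \<Rightarrow> real) \<Rightarrow> bool" where
  "uniformly_supercritical S U J lam mu \<longleftrightarrow>
     (INF j\<in>J. ereal_sqrt (kinetic_floor S U (lam j) (lam (j + 1))) /
               ereal (max \<bar>lam j\<bar> \<bar>lam (j + 1)\<bar>)) > 1 \<and>
     (INF j\<in>J. ereal_sqrt (kinetic_floor S (l2_adjoint S U) (mu j) (mu (j + 1))) /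
               ereal (max \<bar>mu j\<bar> \<bar>mu (j + 1)\<bar>)) > 1"


section \<open>Structural assumptions\<close>

definition hilbert_subspace :: "real set \<Rightarrow> fn set \<Rightarrow> (fn \<Rightarrow> fn \<Rightarrow> complex) \<Rightarrow> bool" where
  "hilbert_subspace T V ip \<longleftrightarrow>
     l2_subspace T V \<and>
     (\<forall>f\<in>V. \<forall>g\<in>V. \<forall>h\<in>V. ip (\<lambda>x. f x + g x) h = ip f h + ip g h) \<and>
     (\<forall>c. \<forall>f\<in>V. \<forall>g\<in>V. ip (\<lambda>x. c * f x) g = c * ip f g) \<and>
     (\<forall>f\<in>V. \<forall>g\<in>V. ip g f = cnj (ip f g)) \<and>
     (\<forall>f\<in>V. 0 \<le> Re (ip f f) \<and> (ip f f = 0 \<longleftrightarrow> ae_eq T f (\<lambda>_. 0))) \<and>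
     (\<forall>s. (\<forall>n::nat. s n \<in> V) \<and>
          (\<forall>e>0. \<exists>N. \<forall>m\<ge>N. \<forall>n\<ge>N. sqrt (Re (ip (\<lambda>x. s m x - s n x) (\<lambda>x. s m x - s n x))) < e)
          \<longrightarrow> (\<exists>f\<in>V. (\<lambda>n. sqrt (Re (ip (\<lambda>x. s n x - f x) (\<lambda>x. s n x - f x)))) \<longlonglongrightarrow> 0))"

definition structural_A1 ::
    "real set \<Rightarrow> opr \<Rightarrow> fn set \<Rightarrow> (fn \<Rightarrow> fn \<Rightarrow> complex) \<Rightarrow> opr \<Rightarrow> bool" where
  "structural_A1 S U XX ip X \<longleftrightarrow>
     hilbert_subspace S XX ip \<and>
     (\<exists>C. \<forall>f\<in>XX. l2_norm S f \<le> C * sqrt (Re (ip f f))) \<and>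
     U `` XX = XX \<and>
     (\<forall>f\<in>XX. \<exists>h. cont_rep S f h) \<and>
     (\<forall>K. compact K \<and> K \<subseteq> S \<longrightarrow>
        (\<exists>C. \<forall>f\<in>XX. \<forall>x\<in>K. cmod (pt_eval S f x) \<le> C * sqrt (Re (ip f f)))) \<and>
     self_adjoint S X \<and> strictly_pos_opr S X \<and>
     XX = Domain (op_sqrt S X) \<and> XX = Range ((op_sqrt S X)\<inverse>)"

definition structural_A2 ::
    "real set \<Rightarrow> opr \<Rightarrow> fn set \<Rightarrow> (fn \<Rightarrow> fn \<Rightarrow> complex) \<Rightarrow> opr \<Rightarrow> bool" where
  "structural_A2 S U XX ip X \<longleftrightarrow>
     (\<forall>f\<in>XX. qval (op_form S X) f =
        1/2 * ((l2_norm S (app (op_sqrt S (mult_sq S)) f))\<^sup>2 +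
               (l2_norm S (app (op_sqrt S (mult_sq S)) (app U f)))\<^sup>2)) \<and>
     XX = Domain (op_sqrt S (mult_sq S)) \<inter> l2_adjoint S U `` Domain (op_sqrt S (mult_sq S)) \<and>
     l2_dense S XX \<and>
     (\<forall>f\<in>XX. ip f f = complex_of_real (2 * qval (op_form S X) f))"

end

theory Submission
  imports Defs
begin

text \<open>
  If \<open>f\<close> vanishes on \<open>\<Lambda>\<close> and \<open>U f\<close> on \<open>M\<close>, the local spectral gaps add up to
  \<open>\<parallel>x U f\<parallel>\<^sup>2 \<ge> c\<^sup>2 \<parallel>x f\<parallel>\<^sup>2\<close> and \<open>\<parallel>x f\<parallel>\<^sup>2 \<ge> d\<^sup>2 \<parallel>x U f\<parallel>\<^sup>2\<close> with \<open>c, d > 1\<close>, hence \<open>x f = 0\<close>.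

  This needs \<open>\<parallel>R f\<parallel> = \<parallel>x V f\<parallel>\<close> for the square root \<open>R\<close> of \<open>V\<^sup>* x\<^sup>2 V\<close>. Uniqueness of the
  square root is avoided: a root exists, namely \<open>V\<^sup>* \<bar>x\<bar> V\<close>, and the form of any self-adjoint
  root \<open>R\<close> is already determined by \<open>R\<^sup>2\<close>, because the vectors \<open>f\<close> with \<open>V f\<close> supported in
  \<open>[-n, n]\<close> for some \<open>n\<close> lie in the domain of \<open>R\<^sup>2\<close> and are a form core.
\<close>

section \<open>The space \<open>L\<^sup>2\<close>\<close>

lemma borel_measurable_ident_lebesgue_on [measurable]:
  "(\<lambda>x::real. x) \<in> borel_measurable (lebesgue_on T)"
  using id_borel_measurable_lebesgue_on[of T] by (simp add: id_def)

lemma borel_measurable_cnj [measurable (raw)]: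
  "f \<in> borel_measurable M \<Longrightarrow> (\<lambda>x. cnj (f x)) \<in> borel_measurable M"
  by (rule measurable_compose[OF _ borel_measurable_continuous_onI])
    (auto intro: continuous_intros)

lemma L2_measurable: "f \<in> L2 T \<Longrightarrow> f \<in> borel_measurable (lebesgue_on T)"
  and L2_integrable: "f \<in> L2 T \<Longrightarrow> integrable (lebesgue_on T) (\<lambda>x. (cmod (f x))\<^sup>2)"
  by (auto simp: L2_def)

lemma L2_dominated:
  assumes "f \<in> borel_measurable (lebesgue_on T)" "g \<in> L2 T" "\<And>x. cmod (f x) \<le> c * cmod (g x)"
  shows "f \<in> L2 T"
proof -
  have "integrable (lebesgue_on T) (\<lambda>x. c\<^sup>2 * (cmod (g x))\<^sup>2)"
    using L2_integrable[OF assms(2)] by simp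
  then have "integrable (lebesgue_on T) (\<lambda>x. (cmod (f x))\<^sup>2)"
  proof (rule Bochner_Integration.integrable_bound)
    show "AE x in lebesgue_on T. norm ((cmod (f x))\<^sup>2) \<le> norm (c\<^sup>2 * (cmod (g x))\<^sup>2)"
      using power_mono[OF assms(3) norm_ge_zero, of _ 2] by (simp add: power_mult_distrib)
  qed (use assms(1) in measurable)
  then show ?thesis using assms(1) by (simp add: L2_def)
qed

lemma L2_ae_eq:
  assumes "f \<in> L2 T" "g \<in> borel_measurable (lebesgue_on T)" "ae_eq T f g"
  shows "g \<in> L2 T"
proof -
  have "integrable (lebesgue_on T) (\<lambda>x. (cmod (g x))\<^sup>2)"
    using L2_integrable[OF assms(1)]
    by (rule integrable_cong_AE_imp) (use assms in \<open>auto simp: ae_eq_def\<close>)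
  then show ?thesis using assms(2) by (simp add: L2_def)
qed

lemma L2_cmul: "f \<in> L2 T \<Longrightarrow> (\<lambda>x. c * f x) \<in> L2 T"
  by (rule L2_dominated[where g = f and c = "cmod c"]) (auto simp: norm_mult dest: L2_measurable)

lemma L2_zero: "(\<lambda>_. 0) \<in> L2 T"
  by (simp add: L2_def)

lemma L2_add:
  assumes "f \<in> L2 T" "g \<in> L2 T"
  shows "(\<lambda>x. f x + g x) \<in> L2 T"
proof -
  note [measurable] = assms[THEN L2_measurable]
  have "integrable (lebesgue_on T) (\<lambda>x. 2 * (cmod (f x))\<^sup>2 + 2 * (cmod (g x))\<^sup>2)"
    using assms[THEN L2_integrable] by simp
  then have "integrable (lebesgue_on T) (\<lambda>x. (cmod (f x + g x))\<^sup>2)"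
  proof (rule Bochner_Integration.integrable_bound)
    have "(cmod (f x + g x))\<^sup>2 \<le> 2 * (cmod (f x))\<^sup>2 + 2 * (cmod (g x))\<^sup>2" for x
      using power_mono[OF norm_triangle_ineq norm_ge_zero, of "f x" "g x" 2]
        sum_squares_bound[of "cmod (f x)" "cmod (g x)"] by (simp add: power2_sum)
    then show "AE x in lebesgue_on T. norm ((cmod (f x + g x))\<^sup>2)
        \<le> norm (2 * (cmod (f x))\<^sup>2 + 2 * (cmod (g x))\<^sup>2)"
      by simp
  qed measurable
  then show ?thesis by (simp add: L2_def)
qed

lemma L2_diff: "f \<in> L2 T \<Longrightarrow> g \<in> L2 T \<Longrightarrow> (\<lambda>x. f x - g x) \<in> L2 T"
  using L2_add[of f T "\<lambda>x. -1 * g x"] L2_cmul[of g T "-1"] by simp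

lemma integrable_mult_cnj:
  assumes "f \<in> L2 T" "g \<in> L2 T"
  shows "integrable (lebesgue_on T) (\<lambda>x. f x * cnj (g x))"
proof -
  note [measurable] = assms[THEN L2_measurable]
  have "integrable (lebesgue_on T) (\<lambda>x. (cmod (f x))\<^sup>2 + (cmod (g x))\<^sup>2)"
    using assms[THEN L2_integrable] by simp
  then show ?thesis
  proof (rule Bochner_Integration.integrable_bound)
    have "cmod (f x) * cmod (g x) \<le> (cmod (f x))\<^sup>2 + (cmod (g x))\<^sup>2" for x
      using sum_squares_bound[of "cmod (f x)" "cmod (g x)"]
        mult_nonneg_nonneg[OF norm_ge_zero norm_ge_zero, of "f x" "g x"] by linarith
    then show "AE x in lebesgue_on T. norm (f x * cnj (g x))
        \<le> norm ((cmod (f x))\<^sup>2 + (cmod (g x))\<^sup>2)"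
      by (simp add: norm_mult)
  qed measurable
qed

lemma l2_norm_nonneg: "0 \<le> l2_norm T f"
  by (simp add: l2_norm_def integral_nonneg_AE)

lemma l2_norm_sq: "(l2_norm T f)\<^sup>2 = (LINT x|lebesgue_on T. (cmod (f x))\<^sup>2)"
  by (simp add: l2_norm_def)

lemma l2_inner_self: "l2_inner T f f = complex_of_real ((l2_norm T f)\<^sup>2)"
  by (simp only: l2_norm_sq l2_inner_def complex_norm_square[symmetric] integral_complex_of_real)

lemma l2_inner_diff_left:
  "f \<in> L2 T \<Longrightarrow> g \<in> L2 T \<Longrightarrow> h \<in> L2 T \<Longrightarrow>
    l2_inner T (\<lambda>x. f x - g x) h = l2_inner T f h - l2_inner T g h"
  unfolding l2_inner_def
  by (simp add: left_diff_distrib integrable_mult_cnj)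

lemma l2_inner_diff_right:
  "f \<in> L2 T \<Longrightarrow> g \<in> L2 T \<Longrightarrow> h \<in> L2 T \<Longrightarrow>
    l2_inner T h (\<lambda>x. f x - g x) = l2_inner T h f - l2_inner T h g"
  unfolding l2_inner_def
  by (simp add: right_diff_distrib integrable_mult_cnj)

lemma l2_inner_cong_ae:
  assumes "ae_eq T f f'" "ae_eq T g g'" "f \<in> L2 T" "f' \<in> L2 T" "g \<in> L2 T" "g' \<in> L2 T"
  shows "l2_inner T f g = l2_inner T f' g'"
  unfolding l2_inner_def
proof (rule integral_cong_AE)
  show "AE x in lebesgue_on T. f x * cnj (g x) = f' x * cnj (g' x)"
    using assms(1,2) unfolding ae_eq_def by eventually_elim simp
qed (intro borel_measurable_integrable integrable_mult_cnj assms)+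

lemma l2_inner_commute: "l2_inner T g f = cnj (l2_inner T f g)"
  unfolding l2_inner_def by (simp add: mult.commute flip: Bochner_Integration.integral_cnj)

lemma l2_norm_diff_sq:
  assumes "f \<in> L2 T" "g \<in> L2 T"
  shows "(l2_norm T (\<lambda>x. f x - g x))\<^sup>2
    = (l2_norm T f)\<^sup>2 - 2 * Re (l2_inner T f g) + (l2_norm T g)\<^sup>2"
proof -
  have "complex_of_real ((l2_norm T (\<lambda>x. f x - g x))\<^sup>2)
      = l2_inner T f f - l2_inner T f g - (l2_inner T g f - l2_inner T g g)"
    using assms
    by (simp only: l2_inner_self[symmetric] l2_inner_diff_left l2_inner_diff_right L2_diff)
  then have "(l2_norm T (\<lambda>x. f x - g x))\<^sup>2
      = Re (l2_inner T f f - l2_inner T f g - (cnj (l2_inner T f g) - l2_inner T g g))"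
    by (metis Re_complex_of_real l2_inner_commute)
  then show ?thesis by (simp add: l2_inner_self)
qed

lemma l2_norm_cong_ae:
  "ae_eq T f g \<Longrightarrow> f \<in> L2 T \<Longrightarrow> g \<in> L2 T \<Longrightarrow> l2_norm T f = l2_norm T g"
  using l2_inner_cong_ae[of T f g f g]
  by (metis l2_inner_self l2_norm_nonneg of_real_eq_iff power2_eq_iff_nonneg)

lemma l2_norm_eq_0_iff:
  assumes "f \<in> L2 T"
  shows "l2_norm T f = 0 \<longleftrightarrow> ae_eq T f (\<lambda>_. 0)"
  using integral_nonneg_eq_0_iff_AE[OF L2_integrable[OF assms]]
  by (simp add: l2_norm_def ae_eq_def)

lemma ae_eq_diff_iff: "ae_eq T (\<lambda>x. f x - g x) (\<lambda>_. 0) \<longleftrightarrow> ae_eq T f g"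
  by (simp add: ae_eq_def)

lemma ae_eq_sym: "ae_eq T f g \<Longrightarrow> ae_eq T g f"
  by (simp add: ae_eq_def eq_commute)

lemma ae_eq_trans: "ae_eq T f g \<Longrightarrow> ae_eq T g h \<Longrightarrow> ae_eq T f h"
  unfolding ae_eq_def by (erule (1) eventually_elim2) simp

lemma ae_eq_mult: "ae_eq T f g \<Longrightarrow> ae_eq T (\<lambda>x. w x * f x) (\<lambda>x. w x * g x)"
  unfolding ae_eq_def by (erule eventually_mono) simp

text \<open>The difference \<open>d\<close> is orthogonal to the dense set \<open>V\<close>, so by
  Pythagoras no \<open>h\<close> in \<open>V\<close> is closer to \<open>d\<close> than
  \<open>0\<close> is, although density provides arbitrarily close ones.\<close>

lemma ae_eq_of_l2_inner:
  assumes "f \<in> L2 T" "g \<in> L2 T" "l2_dense T V"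
    "\<And>h. h \<in> V \<Longrightarrow> l2_inner T h f = l2_inner T h g"
  shows "ae_eq T f g"
proof -
  define d where "d = (\<lambda>x. f x - g x)"
  have d: "d \<in> L2 T" using assms by (simp add: d_def L2_diff)
  have "(l2_norm T d)\<^sup>2 \<le> 0 + e" if "e > 0" for e
  proof -
    obtain h where h: "h \<in> V" "l2_norm T (\<lambda>x. d x - h x) < sqrt e"
      using assms(3) d \<open>e > 0\<close> unfolding l2_dense_def by (metis real_sqrt_gt_0_iff)
    have hL: "h \<in> L2 T" using h(1) assms(3) by (auto simp: l2_dense_def)
    have "l2_inner T h d = 0"
      using assms(4)[OF h(1)] hL assms(1,2) by (simp add: d_def l2_inner_diff_right)
    then have "l2_inner T d h = 0" by (subst l2_inner_commute) simp
    then have "(l2_norm T (\<lambda>x. d x - h x))\<^sup>2 = (l2_norm T d)\<^sup>2 + (l2_norm T h)\<^sup>2"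
      using l2_norm_diff_sq[OF d hL] by simp
    then have "(l2_norm T d)\<^sup>2 \<le> (l2_norm T (\<lambda>x. d x - h x))\<^sup>2" by simp
    also have "\<dots> \<le> (sqrt e)\<^sup>2"
      using h(2) by (intro power_mono) (auto simp: l2_norm_nonneg)
    finally show ?thesis using \<open>e > 0\<close> by simp
  qed
  then have "(l2_norm T d)\<^sup>2 \<le> 0" by (rule field_le_epsilon)
  then have "l2_norm T d = 0" by simp
  then show ?thesis using l2_norm_eq_0_iff[OF d] by (simp add: d_def ae_eq_diff_iff)
qed

lemma l2_dense_L2: "l2_dense T (L2 T)"
proof -
  have "l2_norm T (\<lambda>x. f x - f x) = 0" for f :: fn
    by (simp add: l2_norm_def)
  then show ?thesis unfolding l2_dense_def by (intro conjI ballI allI impI subset_refl) (rule bexI, auto)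
qed

section \<open>Unitary operators\<close>

lemma unitary_L2: "unitary T V \<Longrightarrow> (f, u) \<in> V \<Longrightarrow> f \<in> L2 T \<and> u \<in> L2 T"
  unfolding unitary_def linear_opr_def by blast

lemma unitary_total: "unitary T V \<Longrightarrow> f \<in> L2 T \<Longrightarrow> \<exists>u. (f, u) \<in> V"
  unfolding unitary_def by blast

lemma unitary_surj: "unitary T V \<Longrightarrow> u \<in> L2 T \<Longrightarrow> \<exists>f. (f, u) \<in> V"
  unfolding unitary_def by blast

lemma unitary_inner:
  "unitary T V \<Longrightarrow> (f, u) \<in> V \<Longrightarrow> (g, v) \<in> V \<Longrightarrow> l2_inner T u v = l2_inner T f g"
  unfolding unitary_def by fast

lemma unitary_norm: "unitary T V \<Longrightarrow> (f, u) \<in> V \<Longrightarrow> l2_norm T u = l2_norm T f"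
  using unitary_inner[of T V f u f u]
  by (metis l2_inner_self l2_norm_nonneg of_real_eq_iff power2_eq_iff_nonneg)

lemma unitary_ae_eq:
  assumes "unitary T V" "(f, u) \<in> V" "ae_eq T f g" "ae_eq T u v" "g \<in> L2 T" "v \<in> L2 T"
  shows "(g, v) \<in> V"
proof -
  have "\<forall>(f, f')\<in>V. \<forall>g\<in>L2 T. \<forall>g'\<in>L2 T. ae_eq T f g \<and> ae_eq T f' g' \<longrightarrow> (g, g') \<in> V"
    using assms(1) by (simp add: unitary_def linear_opr_def)
  then show ?thesis using assms(2-) by blast
qed

lemma linear_opr_diff:
  assumes "linear_opr T A" "(f, u) \<in> A" "(g, v) \<in> A"
  shows "((\<lambda>x. f x - g x), (\<lambda>x. u x - v x)) \<in> A"
proof -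
  have add: "\<And>f f' g g'. (f, f') \<in> A \<Longrightarrow> (g, g') \<in> A \<Longrightarrow> ((\<lambda>x. f x + g x), (\<lambda>x. f' x + g' x)) \<in> A"
    and cmul: "\<forall>c. \<forall>(f, f')\<in>A. ((\<lambda>x. c * f x), (\<lambda>x. c * f' x)) \<in> A"
    using assms(1) unfolding linear_opr_def by (blast, simp)
  have "((\<lambda>x. -1 * g x), (\<lambda>x. -1 * v x)) \<in> A"
    using cmul assms(3) by blast
  from add[rule_format, OF assms(2) this]
  show ?thesis by simp
qed

lemma unitary_diff:
  "unitary T V \<Longrightarrow> (f, u) \<in> V \<Longrightarrow> (g, v) \<in> V \<Longrightarrow> ((\<lambda>x. f x - g x), (\<lambda>x. u x - v x)) \<in> V"
  using linear_opr_diff unfolding unitary_def by blast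

lemma unitary_ae_eq_iff:
  assumes "unitary T V" "(f, u) \<in> V" "(g, v) \<in> V"
  shows "ae_eq T u v \<longleftrightarrow> ae_eq T f g"
  using unitary_norm[OF assms(1) unitary_diff[OF assms]]
    unitary_L2[OF assms(1) unitary_diff[OF assms]] l2_norm_eq_0_iff ae_eq_diff_iff
  by metis

lemma ae_eq_refl: "ae_eq T f f"
  by (simp add: ae_eq_def)

text \<open>Since \<open>V\<close> is onto, the defining identity of the adjoint determines all
  inner products of \<open>V h\<close> and forces \<open>V h = g\<close>. With this,
  \<open>kinetic T V\<close> becomes a composition of the graphs of \<open>V\<close>,
  \<open>mult_sq T\<close> and the converse of \<open>V\<close>.\<close>

lemma l2_adjoint_unitary:
  assumes V: "unitary T V"
  shows "l2_adjoint T V = V\<inverse>"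
proof (rule set_eqI, clarify)
  fix g h
  show "(g, h) \<in> l2_adjoint T V \<longleftrightarrow> (g, h) \<in> V\<inverse>"
  proof
    assume "(g, h) \<in> l2_adjoint T V"
    then have gh: "g \<in> L2 T" "h \<in> L2 T" "\<And>f f'. (f, f') \<in> V \<Longrightarrow> l2_inner T f' g = l2_inner T f h"
      unfolding l2_adjoint_def by auto
    obtain h' where h': "(h, h') \<in> V" using unitary_total[OF V gh(2)] by blast
    have "ae_eq T h' g"
    proof (rule ae_eq_of_l2_inner[OF _ gh(1) l2_dense_L2])
      show "h' \<in> L2 T" using unitary_L2[OF V h'] by blast
      show "l2_inner T u h' = l2_inner T u g" if "u \<in> L2 T" for u
        using unitary_surj[OF V that] gh(3) unitary_inner[OF V _ h'] by metis
    qed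
    then show "(g, h) \<in> V\<inverse>"
      using unitary_ae_eq[OF V h' ae_eq_refl] gh(1,2) by simp
  next
    assume "(g, h) \<in> V\<inverse>"
    then show "(g, h) \<in> l2_adjoint T V"
      using unitary_L2[OF V] unitary_inner[OF V] unfolding l2_adjoint_def by auto
  qed
qed

lemma unitary_converse:
  assumes V: "unitary T V"
  shows "unitary T (V\<inverse>)"
proof -
  have lin: "linear_opr T V" using V by (simp add: unitary_def)
  have "ae_eq T f (\<lambda>_. 0)" if "(f, (\<lambda>_. 0)) \<in> V" for f
    using unitary_ae_eq_iff[OF V that, of "\<lambda>_. 0" "\<lambda>_. 0"] lin by (simp add: linear_opr_def ae_eq_refl)
  then have "linear_opr T (V\<inverse>)"
    using lin unfolding linear_opr_def by auto
  moreover have "Domain (V\<inverse>) = L2 T" "Range (V\<inverse>) = L2 T"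
    using V by (auto simp: unitary_def)
  moreover have "\<forall>(f, f')\<in>V\<inverse>. \<forall>(g, g')\<in>V\<inverse>. l2_inner T f' g' = l2_inner T f g"
    using unitary_inner[OF V] by auto
  ultimately show ?thesis unfolding unitary_def by blast
qed

text \<open>The identity operator modulo null sets. It exhibits \<open>mult_sq T\<close> as a
  kinetic operator, so that results on kinetic roots also cover
  \<open>op_sqrt T (mult_sq T)\<close>.\<close>

lemma unitary_ae_identity: "unitary T {(f, g). f \<in> L2 T \<and> g \<in> L2 T \<and> ae_eq T f g}" (is "unitary T ?I")
proof -
  have add: "ae_eq T (\<lambda>x. f x + g x) (\<lambda>x. f' x + g' x)" if "ae_eq T f f'" "ae_eq T g g'" for f f' g g'
    using that unfolding ae_eq_def by eventually_elim simp
  have tr: "ae_eq T g g'" if "ae_eq T f f'" "ae_eq T f g" "ae_eq T f' g'" for f f' g g'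
    using that ae_eq_trans ae_eq_sym by blast
  have "linear_opr T ?I"
    unfolding linear_opr_def
  proof (intro conjI)
    show "\<forall>(f, f')\<in>?I. \<forall>g\<in>L2 T. \<forall>g'\<in>L2 T. ae_eq T f g \<and> ae_eq T f' g' \<longrightarrow> (g, g') \<in> ?I"
      using tr by auto
  qed (auto simp: ae_eq_refl L2_zero L2_add L2_cmul add ae_eq_mult intro: ae_eq_sym)
  moreover have "Domain ?I = L2 T" "Range ?I = L2 T" using ae_eq_refl by auto
  moreover have "\<forall>(f, f')\<in>?I. \<forall>(g, g')\<in>?I. l2_inner T f' g' = l2_inner T f g"
    by (auto intro!: l2_inner_cong_ae intro: ae_eq_sym)
  ultimately show ?thesis
    unfolding unitary_def by blast
qed

section \<open>Truncations and square roots of kinetic operators\<close>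

text \<open>The spectral projection of multiplication by \<open>x\<close> onto
  \<open>[-n, n]\<close>: truncated \<open>L2\<close> functions may be multiplied by any power of
  \<open>x\<close>, and natural \<open>n\<close> keep the family countable.\<close>

definition trunc :: "nat \<Rightarrow> fn \<Rightarrow> fn" where
  "trunc n f = (\<lambda>x. if \<bar>x\<bar> \<le> real n then f x else 0)"

text \<open>The non-negative square root of \<open>mult_sq T\<close>; with \<open>x\<close> in place
  of \<open>|x|\<close> positivity would fail in general.\<close>

definition mult_abs :: "real set \<Rightarrow> opr" where
  "mult_abs T = {(f, g). f \<in> L2 T \<and> g \<in> L2 T \<and> ae_eq T g (\<lambda>x. complex_of_real \<bar>x\<bar> * f x)}"

lemma trunc_measurable [measurable]:
  assumes [measurable]: "f \<in> borel_measurable (lebesgue_on T)"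
  shows "trunc n f \<in> borel_measurable (lebesgue_on T)"
  unfolding trunc_def by measurable

lemma trunc_L2: "f \<in> L2 T \<Longrightarrow> trunc n f \<in> L2 T"
  by (rule L2_dominated[where g = f and c = 1])
    (auto intro: trunc_measurable L2_measurable, simp add: trunc_def)

lemma mult_trunc_L2:
  assumes "f \<in> L2 T"
  shows "(\<lambda>x. complex_of_real x * trunc n f x) \<in> L2 T"
proof (rule L2_dominated[where g = f and c = "real n"])
  note [measurable] = L2_measurable[OF assms]
  show "(\<lambda>x. complex_of_real x * trunc n f x) \<in> borel_measurable (lebesgue_on T)" by measurable
qed (use assms in \<open>auto simp: trunc_def norm_mult mult_right_mono\<close>)

lemma abs_mult_L2_iff:
  assumes "f \<in> L2 T"
  shows "(\<lambda>x. complex_of_real \<bar>x\<bar> * f x) \<in> L2 T \<longleftrightarrow> (\<lambda>x. complex_of_real x * f x) \<in> L2 T"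
proof -
  note [measurable] = L2_measurable[OF assms]
  have "(\<lambda>x. complex_of_real \<bar>x\<bar> * f x) \<in> borel_measurable (lebesgue_on T)"
    "(\<lambda>x. complex_of_real x * f x) \<in> borel_measurable (lebesgue_on T)" by measurable
  then show ?thesis by (simp add: L2_def norm_mult)
qed

lemma mult_sq_trunc_L2:
  "f \<in> L2 T \<Longrightarrow> (\<lambda>x. (complex_of_real x)\<^sup>2 * trunc n f x) \<in> L2 T"
  \<comment> \<open>Truncation is idempotent, so the powers of \<open>x\<close> can be multiplied in
    one at a time.\<close>
  using mult_trunc_L2[OF mult_trunc_L2[of f T n], of n]
  by (rule back_subst[where P = "\<lambda>f. f \<in> L2 T"]) (auto simp: trunc_def power2_eq_square)

text \<open>The bound \<open>x^2 \<le> 1 + x^4\<close> dominates the integrand.\<close>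

lemma mult_sq_L2_imp_mult_L2:
  assumes "f \<in> L2 T" "(\<lambda>x. (complex_of_real x)\<^sup>2 * f x) \<in> L2 T"
  shows "(\<lambda>x. complex_of_real x * f x) \<in> L2 T"
proof -
  note [measurable] = L2_measurable[OF assms(1)]
  have "integrable (lebesgue_on T) (\<lambda>x. (cmod (f x))\<^sup>2 + (cmod ((complex_of_real x)\<^sup>2 * f x))\<^sup>2)"
    using assms[THEN L2_integrable] by simp
  then have "integrable (lebesgue_on T) (\<lambda>x. (cmod (complex_of_real x * f x))\<^sup>2)"
  proof (rule Bochner_Integration.integrable_bound)
    have "x\<^sup>2 \<le> 1 + (x\<^sup>2)\<^sup>2" for x :: real
      using sum_squares_bound[of "x\<^sup>2" 1] zero_le_power2[of x] by (simp, linarith)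
    from mult_right_mono[OF this, of "(cmod (f _))\<^sup>2"]
    show "AE x in lebesgue_on T. norm ((cmod (complex_of_real x * f x))\<^sup>2)
        \<le> norm ((cmod (f x))\<^sup>2 + (cmod ((complex_of_real x)\<^sup>2 * f x))\<^sup>2)"
      by (simp add: norm_mult norm_power power_mult_distrib distrib_right)
  qed measurable
  then show ?thesis by (simp add: L2_def)
qed

text \<open>Dominated convergence with majorant \<open>|f|^2\<close>; at each \<open>x\<close> the
  error is eventually zero.\<close>

lemma trunc_tendsto:
  assumes "f \<in> L2 T"
  shows "(\<lambda>n. l2_norm T (\<lambda>x. trunc n f x - f x)) \<longlonglongrightarrow> 0"
proof -
  note [measurable] = L2_measurable[OF assms]
  have "(\<lambda>n. LINT x|lebesgue_on T. (cmod (trunc n f x - f x))\<^sup>2) \<longlonglongrightarrow> (LINT x|lebesgue_on T. 0)"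
  proof (rule integral_dominated_convergence[where w = "\<lambda>x. (cmod (f x))\<^sup>2"])
    have "(\<lambda>n. (cmod (trunc n f x - f x))\<^sup>2) \<longlonglongrightarrow> 0" for x
    proof (rule tendsto_eventually)
      have "eventually (\<lambda>n. \<bar>x\<bar> \<le> real n) sequentially"
        using filterlim_real_sequentially unfolding filterlim_at_top by blast
      then show "eventually (\<lambda>n. (cmod (trunc n f x - f x))\<^sup>2 = 0) sequentially"
        by eventually_elim (simp add: trunc_def)
    qed
    then show "AE x in lebesgue_on T. (\<lambda>n. (cmod (trunc n f x - f x))\<^sup>2) \<longlonglongrightarrow> 0" by simp
  qed (use L2_integrable[OF assms] in \<open>measurable, auto simp: trunc_def\<close>)
  from tendsto_real_sqrt[OF this] show ?thesis by (simp add: l2_norm_def)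
qed

text \<open>\<open>mult_sq T\<close> fixes \<open>x^2 u\<close> only up to a null set; closure of
  the graph \<open>V\<close> under \<open>ae_eq\<close> allows this exact representative to be
  taken.\<close>

lemma kinetic_iff:
  assumes "unitary T V"
  shows "(f, k) \<in> kinetic T V \<longleftrightarrow>
    (\<exists>u. (f, u) \<in> V \<and> (k, (\<lambda>x. (complex_of_real x)\<^sup>2 * u x)) \<in> V)"
proof
  assume "(f, k) \<in> kinetic T V"
  then obtain u w where uw: "(f, u) \<in> V" "(k, w) \<in> V" "w \<in> L2 T"
    "ae_eq T w (\<lambda>x. (complex_of_real x)\<^sup>2 * u x)"
    unfolding kinetic_def l2_adjoint_unitary[OF assms] mult_sq_def by auto
  have "u \<in> L2 T" using unitary_L2[OF assms uw(1)] by blast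
  note [measurable] = L2_measurable[OF this]
  have "(\<lambda>x. (complex_of_real x)\<^sup>2 * u x) \<in> L2 T"
    by (rule L2_ae_eq[OF uw(3) _ uw(4)]) measurable
  then show "\<exists>u. (f, u) \<in> V \<and> (k, (\<lambda>x. (complex_of_real x)\<^sup>2 * u x)) \<in> V"
    using unitary_ae_eq[OF assms uw(2) ae_eq_refl uw(4)] unitary_L2[OF assms uw(2)] uw(1) by blast
next
  assume "\<exists>u. (f, u) \<in> V \<and> (k, (\<lambda>x. (complex_of_real x)\<^sup>2 * u x)) \<in> V"
  then obtain u where "(f, u) \<in> V" "(k, (\<lambda>x. (complex_of_real x)\<^sup>2 * u x)) \<in> V" by blast
  moreover from this have "(u, (\<lambda>x. (complex_of_real x)\<^sup>2 * u x)) \<in> mult_sq T"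
    using unitary_L2[OF assms] ae_eq_refl unfolding mult_sq_def by blast
  ultimately show "(f, k) \<in> kinetic T V"
    unfolding kinetic_def l2_adjoint_unitary[OF assms] by blast
qed

lemma abs_conj_iff:
  assumes "unitary T V"
  shows "(f, g) \<in> V O mult_abs T O V\<inverse> \<longleftrightarrow>
    (\<exists>u. (f, u) \<in> V \<and> (g, (\<lambda>x. complex_of_real \<bar>x\<bar> * u x)) \<in> V)"
proof
  assume "(f, g) \<in> V O mult_abs T O V\<inverse>"
  then obtain u w where uw: "(f, u) \<in> V" "(g, w) \<in> V" "w \<in> L2 T"
    "ae_eq T w (\<lambda>x. complex_of_real \<bar>x\<bar> * u x)"
    unfolding mult_abs_def by auto
  have "u \<in> L2 T" using unitary_L2[OF assms uw(1)] by blast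
  note [measurable] = L2_measurable[OF this]
  have "(\<lambda>x. complex_of_real \<bar>x\<bar> * u x) \<in> L2 T"
    by (rule L2_ae_eq[OF uw(3) _ uw(4)]) measurable
  then show "\<exists>u. (f, u) \<in> V \<and> (g, (\<lambda>x. complex_of_real \<bar>x\<bar> * u x)) \<in> V"
    using unitary_ae_eq[OF assms uw(2) ae_eq_refl uw(4)] unitary_L2[OF assms uw(2)] uw(1) by blast
next
  assume "\<exists>u. (f, u) \<in> V \<and> (g, (\<lambda>x. complex_of_real \<bar>x\<bar> * u x)) \<in> V"
  then obtain u where "(f, u) \<in> V" "(g, (\<lambda>x. complex_of_real \<bar>x\<bar> * u x)) \<in> V" by blast
  moreover from this have "(u, (\<lambda>x. complex_of_real \<bar>x\<bar> * u x)) \<in> mult_abs T"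
    using unitary_L2[OF assms] ae_eq_refl unfolding mult_abs_def by blast
  ultimately show "(f, g) \<in> V O mult_abs T O V\<inverse>" by blast
qed

text \<open>The point is equality of the maximal domains: if \<open>x^2 u\<close> is in
  \<open>L2\<close>, then so is the intermediate function \<open>|x| u\<close>.\<close>

lemma abs_conj_square:
  assumes V: "unitary T V"
  shows "(V O mult_abs T O V\<inverse>) O (V O mult_abs T O V\<inverse>) = kinetic T V" (is "?R O ?R = _")
proof (rule set_eqI, clarify)
  fix f k
  show "(f, k) \<in> ?R O ?R \<longleftrightarrow> (f, k) \<in> kinetic T V"
  proof
    assume "(f, k) \<in> ?R O ?R"
    then obtain g where "(f, g) \<in> ?R" "(g, k) \<in> ?R" by blast
    then obtain u u' where u: "(f, u) \<in> V" "(g, (\<lambda>x. complex_of_real \<bar>x\<bar> * u x)) \<in> V"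
      "(g, u') \<in> V" "(k, (\<lambda>x. complex_of_real \<bar>x\<bar> * u' x)) \<in> V"
      unfolding abs_conj_iff[OF V] by blast
    have "ae_eq T u' (\<lambda>x. complex_of_real \<bar>x\<bar> * u x)"
      using unitary_ae_eq_iff[OF V u(3) u(2)] by (simp add: ae_eq_refl)
    then have "ae_eq T (\<lambda>x. complex_of_real \<bar>x\<bar> * u' x)
        (\<lambda>x. complex_of_real \<bar>x\<bar> * (complex_of_real \<bar>x\<bar> * u x))"
      by (rule ae_eq_mult)
    then have ae: "ae_eq T (\<lambda>x. complex_of_real \<bar>x\<bar> * u' x) (\<lambda>x. (complex_of_real x)\<^sup>2 * u x)"
      by (simp add: power2_eq_square flip: mult.assoc of_real_mult)
    have L: "(\<lambda>x. complex_of_real \<bar>x\<bar> * u' x) \<in> L2 T" "k \<in> L2 T" "u \<in> L2 T"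
      using unitary_L2[OF V] u by blast+
    note [measurable] = L2_measurable[OF L(3)]
    have "(\<lambda>x. (complex_of_real x)\<^sup>2 * u x) \<in> L2 T"
      by (rule L2_ae_eq[OF L(1) _ ae]) measurable
    then have "(k, (\<lambda>x. (complex_of_real x)\<^sup>2 * u x)) \<in> V"
      using unitary_ae_eq[OF V u(4) ae_eq_refl ae L(2)] by blast
    then show "(f, k) \<in> kinetic T V"
      unfolding kinetic_iff[OF V] using u(1) by blast
  next
    assume "(f, k) \<in> kinetic T V"
    then obtain u where u: "(f, u) \<in> V" "(k, (\<lambda>x. (complex_of_real x)\<^sup>2 * u x)) \<in> V"
      unfolding kinetic_iff[OF V] by blast
    have L: "u \<in> L2 T" "(\<lambda>x. (complex_of_real x)\<^sup>2 * u x) \<in> L2 T"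
      using unitary_L2[OF V] u by blast+
    have "(\<lambda>x. complex_of_real \<bar>x\<bar> * u x) \<in> L2 T"
      using mult_sq_L2_imp_mult_L2[OF L] abs_mult_L2_iff[OF L(1)] by blast
    then obtain g where g: "(g, (\<lambda>x. complex_of_real \<bar>x\<bar> * u x)) \<in> V"
      using unitary_surj[OF V] by blast
    have eq: "(\<lambda>x. (complex_of_real x)\<^sup>2 * u x)
        = (\<lambda>x. complex_of_real \<bar>x\<bar> * (complex_of_real \<bar>x\<bar> * u x))"
      by (simp add: power2_eq_square flip: mult.assoc of_real_mult)
    have "(g, k) \<in> ?R" using g u(2)[unfolded eq] abs_conj_iff[OF V] by blast
    moreover have "(f, g) \<in> ?R" using u(1) g abs_conj_iff[OF V] by blast
    ultimately show "(f, k) \<in> ?R O ?R" by blast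
  qed
qed

lemma l2_norm_minus_commute: "l2_norm T (\<lambda>x. f x - g x) = l2_norm T (\<lambda>x. g x - f x)"
  by (simp add: l2_norm_def norm_minus_commute)

lemma ae_eq_if_trunc:
  assumes "\<And>n. ae_eq T (trunc n f) (\<lambda>_. 0)"
  shows "ae_eq T f (\<lambda>_. 0)"
proof -
  have "AE x in lebesgue_on T. \<forall>n. trunc n f x = 0"
    using assms by (simp add: ae_eq_def AE_all_countable)
  then show ?thesis
    unfolding ae_eq_def
  proof eventually_elim
    case (elim x)
    obtain n where "\<bar>x\<bar> \<le> real n" using real_arch_simple by blast
    then show ?case using spec[OF elim, of n] by (simp add: trunc_def)
  qed
qed

text \<open>The domain contains the preimages of all truncations, hence is dense. For the adjoint,
  testing against such preimages shows that the transform \<open>v\<close> of \<open>h\<close> must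
  be \<open>|x| u\<close>; the opposite inclusion holds because \<open>|x|\<close> is real.\<close>

lemma abs_conj_self_adjoint:
  assumes V: "unitary T V"
  shows "self_adjoint T (V O mult_abs T O V\<inverse>)" (is "self_adjoint T ?R")
  unfolding self_adjoint_def
proof
  have dom: "g \<in> Domain ?R" if "(g, w) \<in> V" "(\<lambda>x. complex_of_real \<bar>x\<bar> * w x) \<in> L2 T" for g w
    using that abs_conj_iff[OF V] unitary_surj[OF V] by (meson DomainI)
  have sub: "Domain ?R \<subseteq> L2 T"
    using abs_conj_iff[OF V] unitary_L2[OF V] by (meson DomainE subsetI)
  have "\<exists>g\<in>Domain ?R. l2_norm T (\<lambda>x. f x - g x) < e" if f: "f \<in> L2 T" and e: "e > 0" for f e
  proof -
    obtain u where u: "(f, u) \<in> V" using unitary_total[OF V f] by blast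
    then have uL: "u \<in> L2 T" using unitary_L2[OF V] by blast
    from order_tendstoD(2)[OF trunc_tendsto[OF this] e]
    obtain n where n: "l2_norm T (\<lambda>x. trunc n u x - u x) < e"
      by (meson eventually_happens trivial_limit_sequentially)
    obtain g where g: "(g, trunc n u) \<in> V" using unitary_surj[OF V trunc_L2[OF uL]] by blast
    have "g \<in> Domain ?R"
      using dom[OF g] abs_mult_L2_iff[OF trunc_L2[OF uL]] mult_trunc_L2[OF uL] by blast
    moreover have "l2_norm T (\<lambda>x. f x - g x) < e"
      using n unitary_norm[OF V unitary_diff[OF V u g]] by (simp add: l2_norm_minus_commute)
    ultimately show ?thesis by blast
  qed
  then show "l2_dense T (Domain ?R)" using sub by (simp add: l2_dense_def)
  show "l2_adjoint T ?R = ?R"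
  proof (rule set_eqI, clarify)
    fix g h
    show "(g, h) \<in> l2_adjoint T ?R \<longleftrightarrow> (g, h) \<in> ?R"
    proof
      assume "(g, h) \<in> l2_adjoint T ?R"
      then have gh: "g \<in> L2 T" "h \<in> L2 T"
        and eq: "\<And>f f'. (f, f') \<in> ?R \<Longrightarrow> l2_inner T f' g = l2_inner T f h"
        unfolding l2_adjoint_def by auto
      obtain u v where u: "(g, u) \<in> V" and v: "(h, v) \<in> V"
        using unitary_total[OF V] gh by blast
      have uv: "u \<in> L2 T" "v \<in> L2 T" using unitary_L2[OF V] u v by blast+
      note [measurable] = uv[THEN L2_measurable]
      \<comment> \<open>The defect \<open>d\<close> is shown to vanish by testing against its own
        truncations; their preimages lie in the domain, though \<open>d\<close> itself need not be
        in \<open>L2\<close>.\<close>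
      define d where "d = (\<lambda>x. complex_of_real \<bar>x\<bar> * u x - v x)"
      have "ae_eq T (trunc n d) (\<lambda>_. 0)" for n
      proof -
        have dL: "trunc n d \<in> L2 T"
        proof -
          have "(\<lambda>x. complex_of_real \<bar>x\<bar> * trunc n u x - trunc n v x) \<in> L2 T"
            using abs_mult_L2_iff[OF trunc_L2[OF uv(1)]] mult_trunc_L2[OF uv(1)]
            by (intro L2_diff trunc_L2 uv) blast
          then show ?thesis
            by (rule back_subst[where P = "\<lambda>f. f \<in> L2 T"]) (auto simp: trunc_def d_def)
        qed
        \<comment> \<open>\<open>mult_trunc_L2\<close> speaks of truncated functions; idempotence
          makes it apply to \<open>trunc n d\<close>.\<close>
        have tt: "trunc n (trunc n d) = trunc n d" by (auto simp: trunc_def)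
        have dL': "(\<lambda>x. complex_of_real \<bar>x\<bar> * trunc n d x) \<in> L2 T"
          using abs_mult_L2_iff[OF dL] mult_trunc_L2[OF dL, of n] tt by simp
        obtain f f' where f: "(f, trunc n d) \<in> V" "(f', (\<lambda>x. complex_of_real \<bar>x\<bar> * trunc n d x)) \<in> V"
          using unitary_surj[OF V] dL dL' by blast
        then have "(f, f') \<in> ?R" using abs_conj_iff[OF V] by blast
        then have "l2_inner T (\<lambda>x. complex_of_real \<bar>x\<bar> * trunc n d x) u = l2_inner T (trunc n d) v"
          using eq unitary_inner[OF V f(2) u] unitary_inner[OF V f(1) v] by simp
        \<comment> \<open>On \<open>[-n, n]\<close> the second factor is
          \<open>|x| cnj u - cnj v\<close>, and elsewhere the first factor vanishes.\<close>
        moreover have "l2_inner T (trunc n d) (trunc n d)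
            = (CLINT x|lebesgue_on T. complex_of_real \<bar>x\<bar> * trunc n d x * cnj (u x) - trunc n d x * cnj (v x))"
          unfolding l2_inner_def
          by (intro Bochner_Integration.integral_cong refl) (auto simp: trunc_def d_def algebra_simps)
        ultimately have "l2_inner T (trunc n d) (trunc n d) = 0"
          using integrable_mult_cnj[OF dL' uv(1)] integrable_mult_cnj[OF dL uv(2)]
          by (simp add: l2_inner_def)
        then show ?thesis using l2_norm_eq_0_iff[OF dL] by (simp add: l2_inner_self)
      qed
      then have "ae_eq T d (\<lambda>_. 0)" by (rule ae_eq_if_trunc)
      then have ae: "ae_eq T v (\<lambda>x. complex_of_real \<bar>x\<bar> * u x)"
        unfolding d_def ae_eq_diff_iff by (rule ae_eq_sym)
      have "(\<lambda>x. complex_of_real \<bar>x\<bar> * u x) \<in> L2 T"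
        by (rule L2_ae_eq[OF uv(2) _ ae]) measurable
      then have "(h, (\<lambda>x. complex_of_real \<bar>x\<bar> * u x)) \<in> V"
        using unitary_ae_eq[OF V v ae_eq_refl ae gh(2)] by blast
      then show "(g, h) \<in> ?R" using u abs_conj_iff[OF V] by blast
    next
      assume "(g, h) \<in> ?R"
      then obtain u where u: "(g, u) \<in> V" "(h, (\<lambda>x. complex_of_real \<bar>x\<bar> * u x)) \<in> V"
        unfolding abs_conj_iff[OF V] by blast
      have "l2_inner T f' g = l2_inner T f h" if ff: "(f, f') \<in> ?R" for f f'
      proof -
        obtain w where w: "(f, w) \<in> V" "(f', (\<lambda>x. complex_of_real \<bar>x\<bar> * w x)) \<in> V"
          using ff unfolding abs_conj_iff[OF V] by blast
        have "l2_inner T (\<lambda>x. complex_of_real \<bar>x\<bar> * w x) u = l2_inner T w (\<lambda>x. complex_of_real \<bar>x\<bar> * u x)"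
          by (simp add: l2_inner_def mult_ac)
        then show ?thesis
          using unitary_inner[OF V w(2) u(1)] unitary_inner[OF V w(1) u(2)] by simp
      qed
      moreover have "g \<in> L2 T" "h \<in> L2 T" using unitary_L2[OF V] u by blast+
      ultimately show "(g, h) \<in> l2_adjoint T ?R" unfolding l2_adjoint_def by blast
    qed
  qed
qed

lemma abs_conj_nonneg:
  assumes V: "unitary T V"
  shows "nonneg_opr T (V O mult_abs T O V\<inverse>)"
proof -
  have "0 \<le> Re (l2_inner T g f)" if fg: "(f, g) \<in> V O mult_abs T O V\<inverse>" for f g
  proof -
    obtain u where u: "(f, u) \<in> V" "(g, (\<lambda>x. complex_of_real \<bar>x\<bar> * u x)) \<in> V"
      using fg unfolding abs_conj_iff[OF V] by blast
    have "l2_inner T g f = l2_inner T (\<lambda>x. complex_of_real \<bar>x\<bar> * u x) u"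
      using unitary_inner[OF V u(2,1)] by simp
    also have "\<dots> = (CLINT x|lebesgue_on T. complex_of_real (\<bar>x\<bar> * (cmod (u x))\<^sup>2))"
      by (simp only: l2_inner_def of_real_mult complex_norm_square mult.assoc)
    also have "\<dots> = complex_of_real (LINT x|lebesgue_on T. \<bar>x\<bar> * (cmod (u x))\<^sup>2)"
      by (rule integral_complex_of_real)
    finally show ?thesis by (simp add: integral_nonneg_AE)
  qed
  then show ?thesis unfolding nonneg_opr_def by blast
qed

text \<open>\<open>V^* |x| V\<close> witnesses that the choice in \<open>op_sqrt\<close> is not
  void, so the chosen root has the required properties; it is not identified with the
  witness.\<close>

lemma op_sqrt_kinetic:
  assumes "unitary T V"
  shows "self_adjoint T (op_sqrt T (kinetic T V))"
    and "op_sqrt T (kinetic T V) O op_sqrt T (kinetic T V) = kinetic T V"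
proof -
  have "\<exists>R. self_adjoint T R \<and> nonneg_opr T R \<and> R O R = kinetic T V"
    using abs_conj_self_adjoint[OF assms] abs_conj_nonneg[OF assms] abs_conj_square[OF assms] by blast
  from someI_ex[OF this] show "self_adjoint T (op_sqrt T (kinetic T V))"
    "op_sqrt T (kinetic T V) O op_sqrt T (kinetic T V) = kinetic T V"
    unfolding op_sqrt_def by blast+
qed

section \<open>Self-adjoint graphs and the form of an arbitrary root of
  \<open>V^* x^2 V\<close>\<close>

lemma self_adjoint_L2: "self_adjoint T R \<Longrightarrow> (f, h) \<in> R \<Longrightarrow> f \<in> L2 T \<and> h \<in> L2 T"
  unfolding self_adjoint_def l2_adjoint_def by blast

lemma self_adjoint_symmetric:
  assumes "self_adjoint T R" "(f, h) \<in> R" "(g, k) \<in> R"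
  shows "l2_inner T k f = l2_inner T g h"
proof -
  have "(f, h) \<in> l2_adjoint T R" using assms(1,2) by (simp add: self_adjoint_def)
  then show ?thesis using assms(3) unfolding l2_adjoint_def by blast
qed

text \<open>Symmetry fixes the inner products of an image with all vectors of the dense
  domain.\<close>

lemma self_adjoint_unique:
  assumes R: "self_adjoint T R" and "(f, h) \<in> R" "(f, h') \<in> R"
  shows "ae_eq T h h'"
proof (rule ae_eq_of_l2_inner)
  show "l2_dense T (Domain R)" using R by (simp add: self_adjoint_def)
  show "l2_inner T g h = l2_inner T g h'" if "g \<in> Domain R" for g
    using that self_adjoint_symmetric[OF R] assms(2,3) by (metis DomainE)
qed (use assms self_adjoint_L2[OF R] in blast)+

text \<open>Closure under differences is inherited from the adjoint, whose defining identity is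
  preserved by differences of pairs.\<close>

lemma self_adjoint_diff:
  assumes R: "self_adjoint T R" and fh: "(f, h) \<in> R" and gk: "(g, k) \<in> R"
  shows "((\<lambda>x. f x - g x), (\<lambda>x. h x - k x)) \<in> R"
proof -
  have L: "f \<in> L2 T" "h \<in> L2 T" "g \<in> L2 T" "k \<in> L2 T"
    using self_adjoint_L2[OF R] fh gk by blast+
  have "((\<lambda>x. f x - g x), (\<lambda>x. h x - k x)) \<in> l2_adjoint T R"
    unfolding l2_adjoint_def
  proof (clarify, intro conjI ballI)
    fix p :: "fn \<times> fn"
    assume p: "p \<in> R"
    obtain a b where ab: "p = (a, b)" by fastforce
    have "a \<in> L2 T" "b \<in> L2 T" using self_adjoint_L2[OF R] p ab by blast+
    then show "case p of (e, e') \<Rightarrow> l2_inner T e' (\<lambda>x. f x - g x) = l2_inner T e (\<lambda>x. h x - k x)"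
      using self_adjoint_symmetric[OF R fh] self_adjoint_symmetric[OF R gk] L p ab
      by (simp add: l2_inner_diff_right)
  qed (use L L2_diff in blast)+
  then show ?thesis using R by (simp add: self_adjoint_def)
qed

text \<open>Here \<open>g\<close> lies in the domain of \<open>R O R\<close>, via
  \<open>g -> r -> k\<close> with \<open>V k = x^2 w\<close>. Symmetry of \<open>R\<close> turns
  \<open><r, h>\<close> into \<open><k, f>\<close>, and \<open>V\<close> turns that into an
  integral, so these inner products do not depend on which root \<open>R\<close> was chosen.\<close>

lemma square_kinetic:
  assumes V: "unitary T V" and R: "self_adjoint T R" "R O R = kinetic T V"
    and gw: "(g, w) \<in> V" and w: "(\<lambda>x. (complex_of_real x)\<^sup>2 * w x) \<in> L2 T"
  obtains r where "(g, r) \<in> R"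
    and "\<And>f h u. (f, h) \<in> R \<Longrightarrow> (f, u) \<in> V \<Longrightarrow>
      l2_inner T r h = l2_inner T (\<lambda>x. (complex_of_real x)\<^sup>2 * w x) u"
proof -
  obtain k where k: "(k, (\<lambda>x. (complex_of_real x)\<^sup>2 * w x)) \<in> V"
    using unitary_surj[OF V w] by blast
  then have "(g, k) \<in> R O R" using gw R(2) kinetic_iff[OF V] by blast
  then obtain r where r: "(g, r) \<in> R" "(r, k) \<in> R" by blast
  show ?thesis
  proof (rule that[OF r(1)])
    fix f h u
    assume "(f, h) \<in> R" "(f, u) \<in> V"
    then show "l2_inner T r h = l2_inner T (\<lambda>x. (complex_of_real x)\<^sup>2 * w x) u"
      using self_adjoint_symmetric[OF R(1) _ r(2)] unitary_inner[OF V k] by metis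
  qed
qed

text \<open>Truncation is an idempotent real multiplier, so the second \<open>u\<close> may be
  truncated as well.\<close>

lemma l2_inner_mult_sq_trunc:
  "l2_inner T (\<lambda>x. (complex_of_real x)\<^sup>2 * trunc n u x) u
    = complex_of_real ((l2_norm T (\<lambda>x. complex_of_real x * trunc n u x))\<^sup>2)"
proof -
  have eq: "(complex_of_real x)\<^sup>2 * trunc n u x * cnj (u x)
      = complex_of_real x * trunc n u x * cnj (complex_of_real x * trunc n u x)" for x
    by (simp add: trunc_def power2_eq_square)
  show ?thesis unfolding l2_inner_self[symmetric] l2_inner_def eq ..
qed

lemma l2_inner_mult_sq:
  "l2_inner T (\<lambda>x. (complex_of_real x)\<^sup>2 * u x) u
    = complex_of_real ((l2_norm T (\<lambda>x. complex_of_real x * u x))\<^sup>2)"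
proof -
  have eq: "(complex_of_real x)\<^sup>2 * u x * cnj (u x)
      = complex_of_real x * u x * cnj (complex_of_real x * u x)" for x
    by (simp add: power2_eq_square)
  show ?thesis unfolding l2_inner_self[symmetric] l2_inner_def eq ..
qed

text \<open>As \<open>u\<close> cut off at \<open>\<bar>x\<bar> \<le> n\<close> lies in the domain of the square, \<open>r\<close> is orthogonal to \<open>h - r\<close>.\<close>

lemma kinetic_root_trunc:
  assumes V: "unitary T V" and R: "self_adjoint T R" "R O R = kinetic T V"
    and fh: "(f, h) \<in> R" and fu: "(f, u) \<in> V" and gu: "(g, trunc n u) \<in> V"
  obtains r where "(g, r) \<in> R"
    and "(l2_norm T (\<lambda>x. h x - r x))\<^sup>2
      = (l2_norm T h)\<^sup>2 - (l2_norm T (\<lambda>x. complex_of_real x * trunc n u x))\<^sup>2"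
proof -
  have uL: "u \<in> L2 T" using unitary_L2[OF V fu] by blast
  obtain r where r: "(g, r) \<in> R" and *: "\<And>f h u'. (f, h) \<in> R \<Longrightarrow> (f, u') \<in> V \<Longrightarrow>
      l2_inner T r h = l2_inner T (\<lambda>x. (complex_of_real x)\<^sup>2 * trunc n u x) u'"
    using square_kinetic[OF V R gu mult_sq_trunc_L2[OF uL]] by blast
  let ?A = "(l2_norm T (\<lambda>x. complex_of_real x * trunc n u x))\<^sup>2"
  have L: "h \<in> L2 T" "r \<in> L2 T" using self_adjoint_L2[OF R(1)] fh r by blast+
  have rr: "l2_inner T r r = complex_of_real ?A"
    using *[OF r gu] l2_inner_mult_sq by simp
  have rh: "l2_inner T r h = complex_of_real ?A"
    using *[OF fh fu] l2_inner_mult_sq_trunc by simp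
  have "(l2_norm T (\<lambda>x. r x - h x))\<^sup>2 = ?A - 2 * ?A + (l2_norm T h)\<^sup>2"
    using l2_norm_diff_sq[OF L(2,1)] rr rh by (simp only: l2_inner_self of_real_eq_iff Re_complex_of_real)
  then show ?thesis by (intro that[OF r]) (simp add: l2_norm_minus_commute[of T h r])
qed

text \<open>Monotone convergence: the truncated integrals increase with \<open>n\<close>, and the
  bound \<open>C\<close> makes them converge.\<close>

lemma mult_L2_if_trunc_bounded:
  assumes u: "u \<in> L2 T"
    and C: "\<And>n. (l2_norm T (\<lambda>x. complex_of_real x * trunc n u x))\<^sup>2 \<le> C"
  shows "(\<lambda>x. complex_of_real x * u x) \<in> L2 T"
proof -
  note [measurable] = L2_measurable[OF u]
  let ?f = "\<lambda>n x. (cmod (complex_of_real x * trunc n u x))\<^sup>2"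
  let ?g = "\<lambda>x. (cmod (complex_of_real x * u x))\<^sup>2"
  have int: "integrable (lebesgue_on T) (?f n)" for n
    using L2_integrable[OF mult_trunc_L2[OF u]] .
  have mono: "mono (\<lambda>n. ?f n x)" for x
    by (rule monoI) (auto simp: trunc_def)
  have lim: "(\<lambda>n. ?f n x) \<longlonglongrightarrow> ?g x" for x
  proof (rule tendsto_eventually)
    have "eventually (\<lambda>n. \<bar>x\<bar> \<le> real n) sequentially"
      using filterlim_real_sequentially unfolding filterlim_at_top by blast
    then show "eventually (\<lambda>n. ?f n x = ?g x) sequentially"
      by eventually_elim (simp add: trunc_def)
  qed
  have "mono (\<lambda>n. LINT x|lebesgue_on T. ?f n x)"
    by (rule monoI) (rule integral_mono[OF int int], rule monoD[OF mono])
  moreover have "(LINT x|lebesgue_on T. ?f n x) \<le> C" for n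
    using C[of n] unfolding l2_norm_sq .
  ultimately obtain L where "(\<lambda>n. LINT x|lebesgue_on T. ?f n x) \<longlonglongrightarrow> L"
    using incseq_convergent by blast
  then have "integrable (lebesgue_on T) ?g"
    by (intro integrable_monotone_convergence[where f = ?f, OF int]) (use mono lim in auto)
  then show ?thesis by (simp add: L2_def)
qed

text \<open>A Bessel inequality: the remainder in \<open>kinetic_root_trunc\<close> is a square, so
  the norm of \<open>x\<close> times \<open>trunc n u\<close> is bounded by that of
  \<open>h\<close>, uniformly in \<open>n\<close>.\<close>

lemma mult_L2_if_kinetic_root:
  assumes V: "unitary T V" and R: "self_adjoint T R" "R O R = kinetic T V"
    and fh: "(f, h) \<in> R" and fu: "(f, u) \<in> V"
  shows "(\<lambda>x. complex_of_real x * u x) \<in> L2 T"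
proof (rule mult_L2_if_trunc_bounded)
  show u: "u \<in> L2 T" using unitary_L2[OF V fu] by blast
  show "(l2_norm T (\<lambda>x. complex_of_real x * trunc n u x))\<^sup>2 \<le> (l2_norm T h)\<^sup>2" for n
  proof -
    obtain g where "(g, trunc n u) \<in> V" using unitary_surj[OF V trunc_L2[OF u]] by blast
    from kinetic_root_trunc[OF V R fh fu this] show ?thesis
      by (metis diff_ge_0_iff_ge zero_le_power2)
  qed
qed

text \<open>\<open>mult_sq T\<close> is the kinetic operator of the identity, so the preceding lemma
  applies with \<open>u = f\<close>. This extracts weighted integrability from the domain condition
  in \<open>structural_A2\<close>.\<close>

lemma mult_L2_if_op_sqrt_mult_sq:
  assumes "f \<in> Domain (op_sqrt T (mult_sq T))"
  shows "f \<in> L2 T" "(\<lambda>x. complex_of_real x * f x) \<in> L2 T"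
proof -
  define V where "V = {(f, g). f \<in> L2 T \<and> g \<in> L2 T \<and> ae_eq T f g}"
  have V: "unitary T V" unfolding V_def by (rule unitary_ae_identity)
  have "mult_sq T = kinetic T V"
  proof (rule set_eqI, clarify)
    fix f k
    show "(f, k) \<in> mult_sq T \<longleftrightarrow> (f, k) \<in> kinetic T V"
    proof
      assume fk: "(f, k) \<in> mult_sq T"
      then have *: "f \<in> L2 T" "k \<in> L2 T" "ae_eq T k (\<lambda>x. (complex_of_real x)\<^sup>2 * f x)"
        by (auto simp: mult_sq_def)
      note [measurable] = L2_measurable[OF *(1)]
      have "(\<lambda>x. (complex_of_real x)\<^sup>2 * f x) \<in> L2 T"
        by (rule L2_ae_eq[OF *(2) _ *(3)]) measurable
      then have "(f, f) \<in> V" "(k, (\<lambda>x. (complex_of_real x)\<^sup>2 * f x)) \<in> V"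
        using * ae_eq_refl by (auto simp: V_def)
      then show "(f, k) \<in> kinetic T V" unfolding kinetic_iff[OF V] by blast
    next
      assume "(f, k) \<in> kinetic T V"
      then obtain u where u: "(f, u) \<in> V" "(k, (\<lambda>x. (complex_of_real x)\<^sup>2 * u x)) \<in> V"
        unfolding kinetic_iff[OF V] by blast
      then have "ae_eq T k (\<lambda>x. (complex_of_real x)\<^sup>2 * u x)" "ae_eq T u f"
        by (auto simp: V_def intro: ae_eq_sym)
      then have "ae_eq T k (\<lambda>x. (complex_of_real x)\<^sup>2 * f x)"
        by (rule ae_eq_trans[OF _ ae_eq_mult])
      then show "(f, k) \<in> mult_sq T" using u by (simp add: mult_sq_def V_def)
    qed
  qed
  then have R: "self_adjoint T (op_sqrt T (mult_sq T))"
    "op_sqrt T (mult_sq T) O op_sqrt T (mult_sq T) = kinetic T V"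
    using op_sqrt_kinetic[OF V] by simp_all
  obtain h where h: "(f, h) \<in> op_sqrt T (mult_sq T)" using assms by blast
  then show "f \<in> L2 T" using self_adjoint_L2[OF R(1)] by blast
  then have "(f, f) \<in> V" by (simp add: V_def ae_eq_refl)
  from mult_L2_if_kinetic_root[OF V R h this] show "(\<lambda>x. complex_of_real x * f x) \<in> L2 T" .
qed

lemma l2_norm_mono:
  assumes "g \<in> L2 T" "f \<in> borel_measurable (lebesgue_on T)" "\<And>x. cmod (f x) \<le> cmod (g x)"
  shows "l2_norm T f \<le> l2_norm T g"
proof -
  have "f \<in> L2 T" by (rule L2_dominated[OF assms(2,1), of 1]) (use assms(3) in simp)
  then show ?thesis
    unfolding l2_norm_def using assms(1,3)
    by (intro real_sqrt_le_mono integral_mono L2_integrable power_mono) auto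
qed

text \<open>Pythagoras for the orthogonal projection \<open>trunc n\<close>, whose remainder tends
  to zero.\<close>

lemma trunc_norm_tendsto:
  assumes v: "v \<in> L2 T"
  shows "(\<lambda>n. (l2_norm T (trunc n v))\<^sup>2) \<longlonglongrightarrow> (l2_norm T v)\<^sup>2"
proof -
  have "(l2_norm T (\<lambda>x. trunc n v x - v x))\<^sup>2 = (l2_norm T v)\<^sup>2 - (l2_norm T (trunc n v))\<^sup>2" for n
  proof -
    have "l2_inner T (trunc n v) v = l2_inner T (trunc n v) (trunc n v)"
      unfolding l2_inner_def by (intro Bochner_Integration.integral_cong refl) (simp add: trunc_def)
    then show ?thesis
      using l2_norm_diff_sq[OF trunc_L2[OF v] v, of n] by (simp add: l2_inner_self)
  qed
  then have *: "(l2_norm T (trunc n v))\<^sup>2 = (l2_norm T v)\<^sup>2 - (l2_norm T (\<lambda>x. trunc n v x - v x))\<^sup>2" for n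
    by simp
  have "(\<lambda>n. (l2_norm T v)\<^sup>2 - (l2_norm T (\<lambda>x. trunc n v x - v x))\<^sup>2) \<longlonglongrightarrow> (l2_norm T v)\<^sup>2 - 0\<^sup>2"
    by (intro tendsto_intros trunc_tendsto[OF v])
  then show ?thesis unfolding * by simp
qed

text \<open>Truncations of \<open>u\<close> pull back to vectors \<open>s n\<close> whose mutual
  form distances are determined by \<open>R O R\<close> alone. They are Cauchy because
  \<open>x u\<close> is in \<open>L2\<close>; closedness puts \<open>f\<close> into the domain, and
  the identity of \<open>kinetic_root_trunc\<close> carries the value to the limit.\<close>

lemma kinetic_form_eq:
  assumes V: "unitary T V" and cl: "closed_form T (kinetic_form T V)"
    and fu: "(f, u) \<in> V" and xu: "(\<lambda>x. complex_of_real x * u x) \<in> L2 T"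
  shows "f \<in> qdom (kinetic_form T V)"
    and "qval (kinetic_form T V) f = (l2_norm T (\<lambda>x. complex_of_real x * u x))\<^sup>2"
proof -
  define R where "R = op_sqrt T (kinetic T V)"
  define q where "q = kinetic_form T V"
  define v where "v = (\<lambda>x. complex_of_real x * u x)"
  have R: "self_adjoint T R" "R O R = kinetic T V"
    using op_sqrt_kinetic[OF V] by (simp_all add: R_def)
  have qd: "qdom q = Domain R" by (simp add: q_def R_def op_form_def)
  have qv: "qval q f = (l2_norm T r)\<^sup>2" if "(f, r) \<in> R" for f r
  proof -
    \<comment> \<open>\<open>app\<close> makes a choice, which is harmless because two images of
      \<open>f\<close> agree almost everywhere.\<close>
    have "(f, app R f) \<in> R" unfolding app_def by (rule someI[of "\<lambda>g. (f, g) \<in> R", OF that])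
    then have "l2_norm T (app R f) = l2_norm T r"
      using l2_norm_cong_ae self_adjoint_unique[OF R(1)] self_adjoint_L2[OF R(1)] that by metis
    then show ?thesis by (simp add: q_def R_def op_form_def)
  qed
  have fL: "f \<in> L2 T" "u \<in> L2 T" using unitary_L2[OF V fu] by blast+
  have vL: "v \<in> L2 T" using xu by (simp add: v_def)
  note [measurable] = L2_measurable[OF vL] L2_measurable[OF fL(2)]
  have "\<forall>n. \<exists>g. (g, trunc n u) \<in> V" using unitary_surj[OF V trunc_L2[OF fL(2)]] by blast
  then obtain s where s: "\<And>n. (s n, trunc n u) \<in> V" by metis
  have xt: "(\<lambda>x. complex_of_real x * trunc n u x) = trunc n v" for n
    by (auto simp: trunc_def v_def)
  have dom: "s n \<in> qdom q" for n
    by (rule square_kinetic[OF V R s[of n] mult_sq_trunc_L2[OF fL(2)]]) (use qd in auto)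
  have qdiff: "qval q (\<lambda>x. s m x - s n x) = (l2_norm T (\<lambda>x. trunc m v x - trunc n v x))\<^sup>2" for m n
  proof -
    let ?w = "\<lambda>x. trunc m u x - trunc n u x"
    have w: "(\<lambda>x. (complex_of_real x)\<^sup>2 * ?w x) \<in> L2 T"
      using L2_diff[OF mult_sq_trunc_L2[OF fL(2), of m] mult_sq_trunc_L2[OF fL(2), of n]]
      by (simp add: right_diff_distrib)
    note sw = unitary_diff[OF V s[of m] s[of n]]
    obtain r where r: "((\<lambda>x. s m x - s n x), r) \<in> R"
      and *: "\<And>f h u. (f, h) \<in> R \<Longrightarrow> (f, u) \<in> V \<Longrightarrow>
        l2_inner T r h = l2_inner T (\<lambda>x. (complex_of_real x)\<^sup>2 * ?w x) u"
      using square_kinetic[OF V R sw w] by blast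
    \<comment> \<open>Testing with the difference \<open>s m - s n\<close> itself makes
      \<open><r, r>\<close> a weighted integral.\<close>
    have "(l2_norm T r)\<^sup>2 = (l2_norm T (\<lambda>x. complex_of_real x * ?w x))\<^sup>2"
      using *[OF r sw] by (simp only: l2_inner_self l2_inner_mult_sq of_real_eq_iff)
    then show ?thesis
      using qv[OF r] by (simp add: right_diff_distrib fun_cong[OF xt])
  qed
  have conv: "(\<lambda>n. l2_norm T (\<lambda>x. s n x - f x)) \<longlonglongrightarrow> 0"
    using trunc_tendsto[OF fL(2)] unitary_norm[OF V unitary_diff[OF V s fu]] by simp
  have cauchy: "\<exists>N. \<forall>m\<ge>N. \<forall>n\<ge>N. qval q (\<lambda>x. s m x - s n x) < e" if e: "e > 0" for e
  proof -
    have "eventually (\<lambda>N. l2_norm T (\<lambda>x. trunc N v x - v x) < sqrt e) sequentially"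
      using order_tendstoD(2)[OF trunc_tendsto[OF vL], of "sqrt e"] e by simp
    then obtain N where N: "l2_norm T (\<lambda>x. trunc N v x - v x) < sqrt e"
      by (meson eventually_happens trivial_limit_sequentially)
    have "qval q (\<lambda>x. s m x - s n x) < e" if mn: "m \<ge> N" "n \<ge> N" for m n
    proof -
      \<comment> \<open>For \<open>m, n\<close> at least \<open>N\<close> the difference is
        supported where \<open>|x| > N\<close> and is bounded there by the tail of
        \<open>v\<close>.\<close>
      have "l2_norm T (\<lambda>x. trunc m v x - trunc n v x) \<le> l2_norm T (\<lambda>x. trunc N v x - v x)"
      proof (rule l2_norm_mono)
        show "(\<lambda>x. trunc N v x - v x) \<in> L2 T" by (intro L2_diff trunc_L2 vL)
        show "(\<lambda>x. trunc m v x - trunc n v x) \<in> borel_measurable (lebesgue_on T)" by measurable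
        show "cmod (trunc m v x - trunc n v x) \<le> cmod (trunc N v x - v x)" for x
          using mn by (auto simp: trunc_def)
      qed
      then have "l2_norm T (\<lambda>x. trunc m v x - trunc n v x) < sqrt e" using N by simp
      then have "(l2_norm T (\<lambda>x. trunc m v x - trunc n v x))\<^sup>2 < (sqrt e)\<^sup>2"
        by (intro power_strict_mono) (auto simp: l2_norm_nonneg)
      then show ?thesis using e by (simp add: qdiff)
    qed
    then show ?thesis by blast
  qed
  have "\<forall>s. \<forall>f\<in>L2 T.
        (\<forall>n::nat. s n \<in> qdom q) \<and>
        (\<lambda>n. l2_norm T (\<lambda>x. s n x - f x)) \<longlonglongrightarrow> 0 \<and>
        (\<forall>e>0. \<exists>N. \<forall>m\<ge>N. \<forall>n\<ge>N. qval q (\<lambda>x. s m x - s n x) < e)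
        \<longrightarrow> f \<in> qdom q \<and> (\<lambda>n. qval q (\<lambda>x. s n x - f x)) \<longlonglongrightarrow> 0"
    using cl unfolding closed_form_def q_def by (elim conjE)
  then have lim: "f \<in> qdom q" "(\<lambda>n. qval q (\<lambda>x. s n x - f x)) \<longlonglongrightarrow> 0"
    using fL(1) dom conv cauchy by blast+
  obtain h where h: "(f, h) \<in> R" using lim(1) qd by blast
  \<comment> \<open>Now that \<open>f\<close> has an image \<open>h\<close>, the remainder identity
    applies to \<open>f\<close>; comparing its limit with the limit \<open>0\<close> from closedness
    identifies \<open>qval q f\<close>.\<close>
  have "qval q (\<lambda>x. s n x - f x) = qval q f - (l2_norm T (trunc n v))\<^sup>2" for n
  proof -
    obtain r where r: "(s n, r) \<in> R" "(l2_norm T (\<lambda>x. h x - r x))\<^sup>2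
        = (l2_norm T h)\<^sup>2 - (l2_norm T (\<lambda>x. complex_of_real x * trunc n u x))\<^sup>2"
      using kinetic_root_trunc[OF V R h fu s] by blast
    show ?thesis
      using qv[OF self_adjoint_diff[OF R(1) r(1) h]] r(2) qv[OF h]
      by (simp add: xt l2_norm_minus_commute[of T r h])
  qed
  then have "(\<lambda>n. qval q f - (l2_norm T (trunc n v))\<^sup>2) \<longlonglongrightarrow> 0" using lim(2) by simp
  moreover have "(\<lambda>n. qval q f - (l2_norm T (trunc n v))\<^sup>2) \<longlonglongrightarrow> qval q f - (l2_norm T v)\<^sup>2"
    by (intro tendsto_intros trunc_norm_tendsto[OF vL])
  ultimately have "qval q f - (l2_norm T v)\<^sup>2 = 0" by (rule LIMSEQ_unique[symmetric])
  then show "f \<in> qdom (kinetic_form T V)"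
    "qval (kinetic_form T V) f = (l2_norm T (\<lambda>x. complex_of_real x * u x))\<^sup>2"
    using lim(1) by (simp_all add: q_def v_def)
qed

section \<open>Kinetic lower bounds\<close>

text \<open>A nonzero \<open>g\<close> competes in the infimum, so its Rayleigh quotient bounds the
  floor and excludes \<open>\<infinity>\<close>; the hypothesis on \<open>c\<close> excludes
  \<open>-\<infinity>\<close>. For \<open>g = 0\<close> the left side is zero.\<close>

lemma spectral_floor_bound:
  assumes g: "g \<in> qdom q" and gL: "g \<in> L2 {a..b}" and nonneg: "0 \<le> qval q g"
    and c: "0 < c" and m: "0 < m"
    and floor: "ereal c \<le> ereal_sqrt (spectral_floor q a b) / ereal m"
  shows "c\<^sup>2 * (m\<^sup>2 * (l2_norm {a..b} g)\<^sup>2) \<le> qval q g"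
proof (cases "ae_eq {a..b} g (\<lambda>_. 0)")
  case True
  then show ?thesis using l2_norm_eq_0_iff[OF gL] nonneg by simp
next
  case False
  then have pos: "0 < (l2_norm {a..b} g)\<^sup>2"
    using l2_norm_eq_0_iff[OF gL] by simp
  have le: "spectral_floor q a b \<le> ereal (qval q g / (l2_norm {a..b} g)\<^sup>2)"
    unfolding spectral_floor_def using g False by (intro INF_lower) blast
  show ?thesis
  proof (cases "spectral_floor q a b")
    case (real r)
    then have "c \<le> sqrt r / m" using floor m by (simp add: ereal_sqrt_def)
    then have cm: "c * m \<le> sqrt r" using m by (simp add: pos_le_divide_eq)
    moreover have "0 < c * m" using c m by simp
    \<comment> \<open>\<open>sqrt\<close> extends to negative reals as an odd function, so
      \<open>0 < r\<close> has to be secured before the square of \<open>sqrt r\<close> can be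
      replaced by \<open>r\<close>.\<close>
    ultimately have "0 < r" by (metis less_le_trans real_sqrt_gt_0_iff)
    then have "(c * m)\<^sup>2 \<le> r"
      using power_mono[OF cm, of 2] \<open>0 < c * m\<close> by simp
    also have "r \<le> qval q g / (l2_norm {a..b} g)\<^sup>2" using le real by simp
    finally show ?thesis
      using pos by (simp add: pos_le_divide_eq power_mult_distrib mult.assoc)
  next
    case PInf
    then show ?thesis using le by simp
  next
    case MInf
    then show ?thesis using floor m by (simp add: ereal_sqrt_def)
  qed
qed

text \<open>A real constant is picked strictly between \<open>1\<close> and the infimum, since the
  infimum itself may be \<open>\<infinity>\<close>.\<close>

lemma ereal_INF_gt_1:
  fixes \<phi> :: "'a \<Rightarrow> ereal"
  assumes "1 < (INF j\<in>J. \<phi> j)"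
  shows "\<exists>c::real. 1 < c \<and> (\<forall>j\<in>J. ereal c \<le> \<phi> j)"
proof -
  obtain c where c: "1 < ereal c" "ereal c < (INF j\<in>J. \<phi> j)" using ereal_dense2[OF assms] by blast
  have "\<forall>j\<in>J. ereal c \<le> \<phi> j" using less_INF_D[OF c(2)] by (blast intro: less_imp_le)
  then show ?thesis using c(1) by (auto simp: one_ereal_def)
qed

lemma sum_le_infsum_ennreal:
  fixes f :: "'a \<Rightarrow> ennreal"
  assumes "finite F" "F \<subseteq> A"
  shows "sum f F \<le> infsum f A"
  unfolding nonneg_infsum_complete[of A f, simplified]
  by (rule SUP_upper) (use assms in simp)

text \<open>A point of \<open>S\<close> outside the open pieces lies on the frontier of the interval
  \<open>S\<close> or among the countably many \<open>a j\<close>; both are null sets.\<close>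

lemma decomposes_AE:
  assumes S: "is_interval S" and dec: "decomposes S J a"
  shows "AE x in lebesgue. x \<in> S \<longrightarrow> x \<in> (\<Union>j\<in>J. {a j<..<a (j + 1)})"
proof -
  have "negligible (frontier S)"
    using S by (intro negligible_convex_frontier) (simp add: is_interval_convex)
  then have "frontier S \<in> null_sets lebesgue" by (simp add: negligible_iff_null_sets)
  then have 1: "AE x in lebesgue. x \<notin> frontier S" by (rule AE_not_in)
  have "countable (a ` J)" by simp
  then have "a ` J \<in> null_sets lebesgue"
    using countable_imp_null_set_lborel by (intro null_sets_completionI) blast
  then have 2: "AE x in lebesgue. x \<notin> a ` J" by (rule AE_not_in)
  from 1 2 show ?thesis
  proof eventually_elim
    case (elim x)
    show ?case
    proof
      assume "x \<in> S"
      then have "x \<in> interior S - a ` J"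
        using elim closure_subset[of S] by (auto simp: frontier_def)
      then show "x \<in> (\<Union>j\<in>J. {a j<..<a (j + 1)})"
        using dec unfolding decomposes_def by blast
    qed
  qed
qed

lemma l2_norm_sq_nn_integral:
  assumes "f \<in> L2 T" "T \<in> sets lebesgue"
  shows "ennreal ((l2_norm T f)\<^sup>2) = (\<integral>\<^sup>+x. ennreal ((cmod (f x))\<^sup>2) * indicator T x \<partial>lebesgue)"
  using nn_integral_eq_integral[OF L2_integrable[OF assms(1)]] assms(2)
  by (simp add: l2_norm_sq nn_integral_restrict_space)

text \<open>On the \<open>j\<close>-th piece \<open>|x|\<close> is at most \<open>m j\<close>, so
  the spectral floor controls the weighted integral there by the confined form. Compatibility adds
  up the pieces, which cover \<open>S\<close> up to a null set. Working with non-negative integrals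
  lets the exhaustion run by monotone convergence.\<close>

lemma kinetic_lower_bound:
  assumes S: "is_interval S" and J: "J = UNIV \<or> J = {0..}" and dec: "decomposes S J a"
    and comp: "dirichlet_compatible S y J a" and f: "f \<in> qdom y"
    and h: "cont_rep S f h" "\<And>j. j \<in> J \<Longrightarrow> h (a j) = 0"
    and xf: "(\<lambda>x. complex_of_real x * f x) \<in> L2 S" and c: "0 < c"
    and floor: "\<And>j. j \<in> J \<Longrightarrow> ereal c \<le>
      ereal_sqrt (spectral_floor (dirichlet_conf y (a j) (a (j + 1))) (a j) (a (j + 1)))
        / ereal (max \<bar>a j\<bar> \<bar>a (j + 1)\<bar>)"
  shows "c\<^sup>2 * (l2_norm S (\<lambda>x. complex_of_real x * f x))\<^sup>2 \<le> qval y f"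
proof -
  define q where "q j = dirichlet_conf y (a j) (a (j + 1))" for j
  define m where "m j = max \<bar>a j\<bar> \<bar>a (j + 1)\<bar>" for j
  define F where "F x = ennreal ((cmod (complex_of_real x * f x))\<^sup>2)" for x
  have cl: "closed_form S y" using comp by (simp add: dirichlet_compatible_def)
  have suc: "j + 1 \<in> J" if "j \<in> J" for j using J that by auto
  have S_leb: "S \<in> sets lebesgue" using S by (simp add: real_interval_borel_measurable)
  have inS: "a j \<in> S" if "j \<in> J" for j using dec that by (auto simp: decomposes_def)
  have lt: "a j < a (j + 1)" if "j \<in> J" for j
    using dec suc[OF that] that by (auto simp: decomposes_def strict_mono_on_def)
  have sub: "{a j..a (j + 1)} \<subseteq> S" if "j \<in> J" for j
    using mem_is_interval_1_I[OF S inS[OF that] inS[OF suc[OF that]]] by auto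
  have conf: "\<And>j. j \<in> J \<Longrightarrow> f \<in> qdom (q j)"
    and total: "(\<Sum>\<^sub>\<infinity>j\<in>J. ennreal (qval (q j) f)) \<le> ennreal (qval y f)"
    using comp f h unfolding dirichlet_compatible_def q_def by blast+
  have nonneg: "0 \<le> qval y g" if "g \<in> qdom y" for g
    using cl that by (simp add: closed_form_def)
  have piece: "ennreal (c\<^sup>2) * (\<integral>\<^sup>+x. F x * indicator {a j<..<a (j + 1)} x \<partial>lebesgue)
      \<le> ennreal (qval (q j) f)" if j: "j \<in> J" for j
  proof -
    let ?I = "{a j..a (j + 1)}"
    have fL: "f \<in> L2 ?I" and ext: "zero_ext ?I f \<in> qdom y"
      using conf[OF j] by (auto simp: q_def dirichlet_conf_def)
    \<comment> \<open>Distinct endpoints cannot both be \<open>0\<close>.\<close>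
    have m: "0 < m j" using lt[OF j] by (auto simp: m_def)
    have "0 \<le> qval (q j) f" using nonneg[OF ext] by (simp add: q_def dirichlet_conf_def)
    from spectral_floor_bound[OF conf[OF j] fL this c m]
    have main: "c\<^sup>2 * ((m j)\<^sup>2 * (l2_norm ?I f)\<^sup>2) \<le> qval (q j) f"
      using floor[OF j] by (simp add: q_def m_def)
    have pw: "F x * indicator {a j<..<a (j + 1)} x
        \<le> ennreal ((cmod (complex_of_real (m j) * f x))\<^sup>2) * indicator ?I x" for x
    proof (cases "x \<in> {a j<..<a (j + 1)}")
      case True
      then have "\<bar>x\<bar> \<le> \<bar>m j\<bar>" by (auto simp: m_def)
      then have "(\<bar>x\<bar> * cmod (f x))\<^sup>2 \<le> (\<bar>m j\<bar> * cmod (f x))\<^sup>2"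
        by (intro power_mono mult_right_mono) auto
      then show ?thesis using True by (simp add: F_def norm_mult ennreal_leI)
    qed simp
    have "(\<integral>\<^sup>+x. F x * indicator {a j<..<a (j + 1)} x \<partial>lebesgue)
        \<le> (\<integral>\<^sup>+x. ennreal ((cmod (complex_of_real (m j) * f x))\<^sup>2) * indicator ?I x \<partial>lebesgue)"
      by (intro nn_integral_mono pw)
    also have "\<dots> = ennreal ((l2_norm ?I (\<lambda>x. complex_of_real (m j) * f x))\<^sup>2)"
      by (rule l2_norm_sq_nn_integral[symmetric]) (use L2_cmul[OF fL] in auto)
    also have "(l2_norm ?I (\<lambda>x. complex_of_real (m j) * f x))\<^sup>2 = (m j)\<^sup>2 * (l2_norm ?I f)\<^sup>2"
      by (simp add: l2_norm_sq norm_mult power_mult_distrib)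
    finally have "ennreal (c\<^sup>2) * (\<integral>\<^sup>+x. F x * indicator {a j<..<a (j + 1)} x \<partial>lebesgue)
        \<le> ennreal (c\<^sup>2) * ennreal ((m j)\<^sup>2 * (l2_norm ?I f)\<^sup>2)"
      by (rule mult_left_mono) simp
    also have "\<dots> \<le> ennreal (qval (q j) f)"
      using main by (simp add: ennreal_mult'[symmetric] ennreal_leI)
    finally show ?thesis .
  qed
  \<comment> \<open>\<open>F\<close> is known to be measurable on \<open>S\<close> only; the
    indicator of \<open>S\<close> transfers this to the whole line, and every piece lies inside
    \<open>S\<close>.\<close>
  have "(\<lambda>x. (cmod (complex_of_real x * f x))\<^sup>2) \<in> borel_measurable (lebesgue_on S)"
    using L2_measurable[OF xf] by measurable
  then have "F \<in> borel_measurable (lebesgue_on S)" unfolding F_def by measurable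
  then have meas: "(\<lambda>x. F x * indicator S x) \<in> borel_measurable lebesgue"
    using S_leb by (simp add: borel_measurable_restrict_space_iff_ennreal)
  have [measurable]: "{a j<..<a (j + 1)} \<in> sets lebesgue" for j by simp
  have piece_meas: "(\<lambda>x. F x * indicator {a j<..<a (j + 1)} x) \<in> borel_measurable lebesgue"
    if "j \<in> J" for j
  proof -
    note [measurable] = meas
    have "(\<lambda>x. (F x * indicator S x) * indicator {a j<..<a (j + 1)} x) \<in> borel_measurable lebesgue"
      by measurable
    moreover have "(F x * indicator S x) * indicator {a j<..<a (j + 1)} x
        = F x * indicator {a j<..<a (j + 1)} x" for x
      using subsetD[OF sub[OF that], of x] by (auto simp: indicator_def)
    ultimately show ?thesis by simp
  qed
  \<comment> \<open>Finite windows of indices exhaust \<open>J\<close>: their sums compare with the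
    \<open>ennreal\<close> sum, and the limit is taken afterwards.\<close>
  define K where "K n = J \<inter> {- int n..int n}" for n
  define D where "D n = (\<Union>j\<in>K n. {a j<..<a (j + 1)})" for n
  have K: "finite (K n)" "K n \<subseteq> J" for n by (auto simp: K_def)
  have D_leb [measurable]: "D n \<in> sets lebesgue" for n unfolding D_def using K by auto
  have D_sub: "D n \<subseteq> S" for n using sub K by (fastforce simp: D_def)
  have D_mono: "D n \<subseteq> D n'" if "n \<le> n'" for n n' using that by (auto simp: D_def K_def)
  have D_bound: "ennreal (c\<^sup>2) * (\<integral>\<^sup>+x. F x * indicator (D n) x \<partial>lebesgue) \<le> ennreal (qval y f)" for n
  proof -
    have "F x * indicator (D n) x \<le> (\<Sum>j\<in>K n. F x * indicator {a j<..<a (j + 1)} x)" for x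
    proof (cases "x \<in> D n")
      case True
      then obtain j where j: "j \<in> K n" "x \<in> {a j<..<a (j + 1)}" by (auto simp: D_def)
      then have "F x * indicator (D n) x = F x * indicator {a j<..<a (j + 1)} x" using True by simp
      also have "\<dots> \<le> (\<Sum>j\<in>K n. F x * indicator {a j<..<a (j + 1)} x)"
        by (rule member_le_sum) (use j K in auto)
      finally show ?thesis .
    qed simp
    then have "(\<integral>\<^sup>+x. F x * indicator (D n) x \<partial>lebesgue)
        \<le> (\<integral>\<^sup>+x. (\<Sum>j\<in>K n. F x * indicator {a j<..<a (j + 1)} x) \<partial>lebesgue)"
      by (rule nn_integral_mono)
    also have "\<dots> = (\<Sum>j\<in>K n. \<integral>\<^sup>+x. F x * indicator {a j<..<a (j + 1)} x \<partial>lebesgue)"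
      by (rule nn_integral_sum) (use piece_meas K in blast)
    finally have "ennreal (c\<^sup>2) * (\<integral>\<^sup>+x. F x * indicator (D n) x \<partial>lebesgue)
        \<le> (\<Sum>j\<in>K n. ennreal (c\<^sup>2) * (\<integral>\<^sup>+x. F x * indicator {a j<..<a (j + 1)} x \<partial>lebesgue))"
      unfolding sum_distrib_left[symmetric] by (rule mult_left_mono) simp
    also have "\<dots> \<le> (\<Sum>j\<in>K n. ennreal (qval (q j) f))"
      using K by (intro sum_mono piece) blast
    also have "\<dots> \<le> (\<Sum>\<^sub>\<infinity>j\<in>J. ennreal (qval (q j) f))"
      by (rule sum_le_infsum_ennreal[OF K])
    finally show ?thesis using total by simp
  qed
  have "AE x in lebesgue. F x * indicator S x = (SUP n. F x * indicator (D n) x)"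
    using decomposes_AE[OF S dec]
  proof eventually_elim
    case (elim x)
    show ?case
    proof (cases "x \<in> S")
      case True
      then obtain j where j: "j \<in> J" "x \<in> {a j<..<a (j + 1)}" using elim by blast
      \<comment> \<open>\<open>nat |j|\<close> is the first window that contains
        \<open>j\<close>.\<close>
      moreover have "j \<in> K (nat \<bar>j\<bar>)" using j(1) by (auto simp: K_def)
      ultimately have "x \<in> D (nat \<bar>j\<bar>)" by (auto simp: D_def)
      then have "F x \<le> (SUP n. F x * indicator (D n) x)"
        by (intro SUP_upper2[of "nat \<bar>j\<bar>"]) auto
      moreover have "(SUP n. F x * indicator (D n) x) \<le> F x"
        by (intro SUP_least) (simp add: indicator_def)
      ultimately show ?thesis using True by simp
    next
      case False
      then have "x \<notin> D n" for n using D_sub by blast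
      then show ?thesis using False by simp
    qed
  qed
  then have "(\<integral>\<^sup>+x. F x * indicator S x \<partial>lebesgue) = (\<integral>\<^sup>+x. (SUP n. F x * indicator (D n) x) \<partial>lebesgue)"
    by (rule nn_integral_cong_AE)
  also have "\<dots> = (SUP n. \<integral>\<^sup>+x. F x * indicator (D n) x \<partial>lebesgue)"
  proof (rule nn_integral_monotone_convergence_SUP)
    show "incseq (\<lambda>n x. F x * indicator (D n) x)"
      using D_mono[OF le_SucI[OF order_refl]]
      by (intro incseq_SucI le_funI mult_left_mono) (auto simp: indicator_def)
    show "(\<lambda>x. F x * indicator (D n) x) \<in> borel_measurable lebesgue" for n
    proof -
      note [measurable] = meas
      have "(\<lambda>x. (F x * indicator S x) * indicator (D n) x) \<in> borel_measurable lebesgue"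
        by measurable
      moreover have "(F x * indicator S x) * indicator (D n) x = F x * indicator (D n) x" for x
        using D_sub by (auto simp: indicator_def)
      ultimately show ?thesis by simp
    qed
  qed
  finally have "ennreal (c\<^sup>2) * (\<integral>\<^sup>+x. F x * indicator S x \<partial>lebesgue)
      = (SUP n. ennreal (c\<^sup>2) * (\<integral>\<^sup>+x. F x * indicator (D n) x \<partial>lebesgue))"
    by (simp add: SUP_mult_left_ennreal)
  also have "\<dots> \<le> ennreal (qval y f)" by (intro SUP_least D_bound)
  finally have "ennreal (c\<^sup>2) * ennreal ((l2_norm S (\<lambda>x. complex_of_real x * f x))\<^sup>2) \<le> ennreal (qval y f)"
    using l2_norm_sq_nn_integral[OF xf S_leb] by (simp add: F_def)
  then show ?thesis
    using nonneg[OF f] by (simp add: ennreal_mult'[symmetric])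
qed

text \<open>The second point \<open>z\<close> makes \<open>S\<close> nondegenerate: a nonzero value
  of \<open>h\<close> at \<open>x\<close> would persist, by continuity, on a nonempty open subset of
  \<open>S\<close>, although \<open>h = 0\<close> almost everywhere.\<close>

lemma cont_rep_eq_0:
  assumes S: "is_interval S" and xz: "x \<in> S" "z \<in> S" "x \<noteq> z"
    and h: "cont_rep S f h" and f: "ae_eq S f (\<lambda>_. 0)"
  shows "h x = 0"
proof (rule ccontr)
  assume hx: "h x \<noteq> 0"
  have "continuous (at x within S) h"
    using h xz(1) by (simp add: cont_rep_def continuous_on_eq_continuous_within)
  from continuous_within_avoid[OF this hx]
  obtain d where d: "d > 0" "\<And>y. y \<in> S \<Longrightarrow> dist x y < d \<Longrightarrow> h y \<noteq> 0" by blast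
  \<comment> \<open>As \<open>x\<close> may be an endpoint of \<open>S\<close>, the ball is cut down
    to the open interval between \<open>x\<close> and \<open>z\<close>, which stays inside
    \<open>S\<close>.\<close>
  define A where "A = ball x d \<inter> {min x z<..<max x z}"
  have "x \<in> closure {min x z<..<max x z}"
    using xz(3) by (subst closure_greaterThanLessThan) auto
  then obtain y where "y \<in> {min x z<..<max x z}" "dist y x < d"
    using d(1) unfolding closure_approachable by blast
  then have "A \<noteq> {}" by (auto simp: A_def dist_commute)
  moreover have "open A" by (simp add: A_def open_Int)
  ultimately have "\<not> negligible A" by (rule open_not_negligible[rotated])
  moreover have "A \<in> null_sets lebesgue"
  proof -
    have "A \<subseteq> S"
    proof
      fix y assume "y \<in> A"
      then have "min x z \<le> y" "y \<le> max x z" by (auto simp: A_def)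
      then show "y \<in> S"
        using mem_is_interval_1_I[OF S, of "min x z" "max x z" y] xz by (auto simp: min_def max_def split: if_splits)
    qed
    have "ae_eq S h (\<lambda>_. 0)" using h f ae_eq_sym ae_eq_trans unfolding cont_rep_def by blast
    then have "AE y in lebesgue. y \<in> S \<longrightarrow> h y = 0"
      using S by (simp add: ae_eq_def AE_restrict_space_iff real_interval_borel_measurable)
    then have "AE y in lebesgue. y \<notin> A"
      by eventually_elim (use \<open>A \<subseteq> S\<close> d(2) in \<open>auto simp: A_def\<close>)
    then show ?thesis using \<open>open A\<close> by (simp add: AE_iff_null_sets)
  qed
  ultimately show False by (simp add: negligible_iff_null_sets)
qed

theorem theorem3p3:
  fixes S :: "real set" and U X :: opr and XX :: "fn set"
    and ip :: "fn \<Rightarrow> fn \<Rightarrow> complex"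
    and J :: "int set" and lam mu :: "int \<Rightarrow> real"
  assumes "is_interval S"
    and "unitary S U"
    and "structural_A1 S U XX ip X"
    and "structural_A2 S U XX ip X"
    and "J = UNIV \<or> J = {0..}"
    and "decomposes S J lam"
    and "decomposes S J mu"
    and "kinetic_admissible S U J lam mu"
    and "uniformly_supercritical S U J lam mu"
  shows "\<forall>f\<in>XX. (\<forall>i\<in>J. pt_eval S f (lam i) = 0) \<and> (\<forall>i\<in>J. pt_eval S (app U f) (mu i) = 0)
           \<longleftrightarrow> ae_eq S f (\<lambda>_. 0)"
proof
  fix f assume f: "f \<in> XX"
  have U': "unitary S (l2_adjoint S U)"
    using unitary_converse[OF assms(2)] l2_adjoint_unitary[OF assms(2)] by simp
  have dom: "XX \<subseteq> Domain (op_sqrt S (mult_sq S))"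
    using assms(4) by (auto simp: structural_A2_def)
  have cont: "\<And>f. f \<in> XX \<Longrightarrow> \<exists>h. cont_rep S f h" and UX: "U `` XX = XX"
    using assms(3) by (auto simp: structural_A1_def)
  define g where "g = app U f"
  have fL: "f \<in> L2 S" and xf: "(\<lambda>x. complex_of_real x * f x) \<in> L2 S"
    using mult_L2_if_op_sqrt_mult_sq f dom by blast+
  have fg: "(f, g) \<in> U"
    unfolding g_def app_def using unitary_total[OF assms(2) fL] by (rule someI_ex)
  then have g: "g \<in> XX" using f UX by blast
  have gL: "g \<in> L2 S" and xg: "(\<lambda>x. complex_of_real x * g x) \<in> L2 S"
    using mult_L2_if_op_sqrt_mult_sq g dom by blast+
  define hf hg where "hf = (SOME h. cont_rep S f h)" and "hg = (SOME h. cont_rep S g h)"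
  have hf: "cont_rep S f hf" and hg: "cont_rep S g hg"
    unfolding hf_def hg_def using someI_ex[OF cont[OF f]] someI_ex[OF cont[OF g]] .
  have pt: "pt_eval S f = hf" "pt_eval S (app U f) = hg"
    by (simp_all add: fun_eq_iff pt_eval_def hf_def hg_def g_def)
  show "(\<forall>i\<in>J. pt_eval S f (lam i) = 0) \<and> (\<forall>i\<in>J. pt_eval S (app U f) (mu i) = 0)
           \<longleftrightarrow> ae_eq S f (\<lambda>_. 0)"
  proof
    assume zero: "(\<forall>i\<in>J. pt_eval S f (lam i) = 0) \<and> (\<forall>i\<in>J. pt_eval S (app U f) (mu i) = 0)"
    have comp: "dirichlet_compatible S (kinetic_form S U) J lam"
      "dirichlet_compatible S (kinetic_form S (l2_adjoint S U)) J mu"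
      using assms(8) by (auto simp: kinetic_admissible_def)
    then have cl: "closed_form S (kinetic_form S U)" "closed_form S (kinetic_form S (l2_adjoint S U))"
      by (auto simp: dirichlet_compatible_def)
    have gf: "(g, f) \<in> l2_adjoint S U" using fg l2_adjoint_unitary[OF assms(2)] by simp
    let ?A = "(l2_norm S (\<lambda>x. complex_of_real x * f x))\<^sup>2"
    let ?B = "(l2_norm S (\<lambda>x. complex_of_real x * g x))\<^sup>2"
    \<comment> \<open>The adjoint sends \<open>g\<close> back to \<open>f\<close>, so the roles are
      exchanged: the kinetic energy of \<open>f\<close> is \<open>?B\<close> and that of
      \<open>g\<close> is \<open>?A\<close>.\<close>
    note kf = kinetic_form_eq[OF assms(2) cl(1) fg xg]
    note kg = kinetic_form_eq[OF U' cl(2) gf xf]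
    note sup = assms(9)[unfolded uniformly_supercritical_def kinetic_floor_def]
    obtain c where c: "1 < c" "\<forall>j\<in>J. ereal c \<le>
        ereal_sqrt (spectral_floor (dirichlet_conf (kinetic_form S U) (lam j) (lam (j + 1)))
          (lam j) (lam (j + 1))) / ereal (max \<bar>lam j\<bar> \<bar>lam (j + 1)\<bar>)"
      using ereal_INF_gt_1[OF conjunct1[OF sup]] by (elim exE conjE)
    obtain d where d: "1 < d" "\<forall>j\<in>J. ereal d \<le>
        ereal_sqrt (spectral_floor (dirichlet_conf (kinetic_form S (l2_adjoint S U)) (mu j) (mu (j + 1)))
          (mu j) (mu (j + 1))) / ereal (max \<bar>mu j\<bar> \<bar>mu (j + 1)\<bar>)"
      using ereal_INF_gt_1[OF conjunct2[OF sup]] by (elim exE conjE)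
    have "c\<^sup>2 * ?A \<le> ?B"
      using kinetic_lower_bound[OF assms(1,5,6) comp(1) kf(1) hf _ xf _ c(2)[rule_format]] zero c(1) kf(2) pt
      by simp
    moreover have "d\<^sup>2 * ?B \<le> ?A"
      using kinetic_lower_bound[OF assms(1,5,7) comp(2) kg(1) hg _ xg _ d(2)[rule_format]] zero d(1) kg(2) pt
      by simp
    \<comment> \<open>This closes the chain \<open>c^2 A \<le> B \<le> d^2 B \<le> A\<close>, and
      \<open>c > 1\<close> then leaves only \<open>A = 0\<close>.\<close>
    moreover have "1 * ?B \<le> d\<^sup>2 * ?B" using d(1) by (intro mult_right_mono) auto
    ultimately have "(c\<^sup>2 - 1) * ?A \<le> 0" by (simp add: algebra_simps)
    moreover have "0 < c\<^sup>2 - 1" using c(1) by simp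
    ultimately have "?A \<le> 0" by (simp only: mult_le_0_iff) linarith
    then have "ae_eq S (\<lambda>x. complex_of_real x * f x) (\<lambda>_. 0)"
      using l2_norm_eq_0_iff[OF xf] by simp
    then have 1: "AE x in lebesgue. x \<in> S \<longrightarrow> complex_of_real x * f x = 0"
      using assms(1) by (simp add: ae_eq_def AE_restrict_space_iff real_interval_borel_measurable)
    \<comment> \<open>Vanishing of \<open>x f\<close> gives no information at the single point
      \<open>x = 0\<close>.\<close>
    have "{0::real} \<in> null_sets lebesgue"
      using countable_imp_null_set_lborel[of "{0}"] by (intro null_sets_completionI) simp
    then have "AE x in lebesgue. (x::real) \<notin> {0}" by (rule AE_not_in)
    with 1 have "AE x in lebesgue. x \<in> S \<longrightarrow> f x = 0"
      by eventually_elim auto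
    then show "ae_eq S f (\<lambda>_. 0)"
      using assms(1) by (simp add: ae_eq_def AE_restrict_space_iff real_interval_borel_measurable)
  next
    \<comment> \<open>Conversely, the zero class satisfies the sampling conditions, whichever
      continuous representatives \<open>pt_eval\<close> has chosen.\<close>
    assume f0: "ae_eq S f (\<lambda>_. 0)"
    have "((\<lambda>_. 0), (\<lambda>_. 0)) \<in> U"
      using assms(2) by (simp add: unitary_def linear_opr_def)
    then have g0: "ae_eq S g (\<lambda>_. 0)" using unitary_ae_eq_iff[OF assms(2) fg] f0 by blast
    have vanish: "\<forall>i\<in>J. h (a i) = 0"
      if "decomposes S J a" "cont_rep S k h" "ae_eq S k (\<lambda>_. 0)" for a k h
    proof
      fix i assume i: "i \<in> J"
      \<comment> \<open>The index set is closed under successors, so the next sampling point serves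
        as the second point of \<open>S\<close>.\<close>
      then have "i + 1 \<in> J" using assms(5) by auto
      then have "a i \<in> S" "a (i + 1) \<in> S" "a i \<noteq> a (i + 1)"
        using that(1) i by (force simp: decomposes_def strict_mono_on_def)+
      then show "h (a i) = 0" using cont_rep_eq_0[OF assms(1) _ _ _ that(2,3)] by blast
    qed
    show "(\<forall>i\<in>J. pt_eval S f (lam i) = 0) \<and> (\<forall>i\<in>J. pt_eval S (app U f) (mu i) = 0)"
      unfolding pt using vanish[OF assms(6) hf f0] vanish[OF assms(7) hg g0] by blast
  qed
qed

end
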